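(* Let $\mathcal{G}$ be a decomposable graph, $\mathcal{P}=(C_1,\ldots,C_r)$ a perfect order of its cliques, and $\mathcal{D}$ a DAG version of $\mathcal{G}$ induced by $\mathcal{P}$. Then the set of $(\alpha,\beta)\in\mathbb{R}^r\times\mathbb{R}^{r-1}$ satisfying $$\int_{\mathrm{P}_{\mathcal{G}}}\omega_{\mathrm{P}_{\mathcal{G}}}(\alpha,\beta,U^E,d\Omega)<\infty\quad\text{for every }U^E\in\mathrm{Q}_{\mathcal{G}}$$ has dimension, as a manifold, greater than or equal to $r+r_{\mathcal{D}}$ (i.e. it contains a submanifold of $\mathbb{R}^r\times\mathbb{R}^{r-1}$ of dimension at least $r+r_{\mathcal{D}}$), where $r_{\mathcal{D}}$ is the number of distinct separators of $\mathcal{G}$ that are ancestral in $\mathcal{D}$.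
   Context: Let $\mathcal{G}=(V,E)$ be a decomposable (chordal) undirected graph, $V=\{1,\ldots,p\}$; all loops are regarded as belonging to $E$. "Clique" means maximal complete vertex set. A perfect order of the cliques is an enumeration $\mathcal{P}=(C_1,\ldots,C_r)$ of all cliques such that, with $H_j=C_1\cup\cdots\cup C_j$, each separator $S_j=H_{j-1}\cap C_j$ ($2\le j\le r$) is contained in some $C_i$, $i<j$. Put $c_j=|C_j|$, $s_j=|S_j|$. A DAG version of $\mathcal{G}$ is an acyclic directed graph $\mathcal{D}$ whose underlying undirected graph is $\mathcal{G}$. A set $A\subseteq V$ is ancestral in $\mathcal{D}$ if it contains the parents of all its members. $\mathcal{D}$ is induced by $\mathcal{P}$ if $H_1,\ldots,H_{r-1}$ are all ancestral in $\mathcal{D}$. $\mathrm{P}_{\mathcal{G}}$ is the set of positive definite $p\times p$ matrices $\Omega$ with $\Omega_{ij}=0$ whenever $\{i,j\}\notin E$; $\mathrm{PD}_{\mathcal{G}}=\{\Omega^{-1}:\Omega\in\mathrm{P}_{\mathcal{G}}\}$. $\mathrm{Q}_{\mathcal{G}}$ is the set of symmetric incomplete matrices $(\Gamma_{ij})_{\{i,j\}\in E}$ with $\Gamma_C$ positive definite for each clique $C$. Each $\Sigma^E\in\mathrm{Q}_{\mathcal{G}}$ has a unique completion $\Sigma\in\mathrm{PD}_{\mathcal{G}}$ agreeing with it on $E$; for $\Omega\in\mathrm{P}_{\mathcal{G}}$, $\Omega^{-E}:=(\Omega^{-1})^E$. For $\alpha\in\mathbb{R}^r$, $\beta=(\beta_2,\ldots,\beta_r)\in\mathbb{R}^{r-1}$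 let $H_{\mathcal{G}}(\alpha,\beta,\Sigma^E)=\prod_{i=1}^r\det(\Sigma_{C_i})^{\alpha_i}/\prod_{i=2}^r\det(\Sigma_{S_i})^{\beta_i}$. Let $\nu_{\mathcal{G}}(d\Omega)=H_{\mathcal{G}}(\tfrac{c+1}{2},\tfrac{s+1}{2},\Omega^{-E})\,d\Omega$ with $c=(c_1,\ldots,c_r)$, $s=(s_2,\ldots,s_r)$, and $d\Omega$ Lebesgue measure on $\mathrm{P}_{\mathcal{G}}$. For $U^E\in\mathrm{Q}_{\mathcal{G}}$ with completion $U$, $$\omega_{\mathrm{P}_{\mathcal{G}}}(\alpha,\beta,U^E,d\Omega)=e^{-\mathrm{tr}(\Omega U)}H_{\mathcal{G}}(\alpha,\beta,\Omega^{-E})\,\nu_{\mathcal{G}}(d\Omega).$$ *)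

theory Defs
  imports "HOL-Analysis.Analysis"
begin

section \<open>Graphs\<close>

text \<open>The vertex set is the finite type \<open>'v\<close>. An undirected graph is its edge relation \<open>E\<close>,
  which is symmetric and contains all loops.\<close>

definition ugraph :: "'v rel \<Rightarrow> bool" where
  "ugraph E \<longleftrightarrow> refl E \<and> sym E"

text \<open>Chordality: every cycle \<open>vs\<close> of length at least 4 has a chord, that is, an edge
  between two vertices of the cycle that are not consecutive on it.\<close>

definition decomposable :: "'v rel \<Rightarrow> bool" where
  "decomposable E \<longleftrightarrow>
    (\<forall>vs. distinct vs \<and> 4 \<le> length vs \<and>
       (\<forall>i<length vs. (vs ! i, vs ! ((i + 1) mod length vs)) \<in> E) \<longrightarrow>
       (\<exists>i<length vs. \<exists>j<length vs.
          i \<noteq> j \<and> j \<noteq> (i + 1) mod length vs \<and> i \<noteq> (j + 1) mod length vs \<and>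
          (vs ! i, vs ! j) \<in> E))"

definition complete_in :: "'v rel \<Rightarrow> 'v set \<Rightarrow> bool" where
  "complete_in E A \<longleftrightarrow> (\<forall>u\<in>A. \<forall>v\<in>A. (u, v) \<in> E)"

definition cliques :: "'v rel \<Rightarrow> 'v set set" where
  "cliques E = {A. complete_in E A \<and> (\<forall>B. complete_in E B \<and> A \<subseteq> B \<longrightarrow> B = A)}"

definition history :: "(nat \<Rightarrow> 'v set) \<Rightarrow> nat \<Rightarrow> 'v set" where
  "history C j = (\<Union>i\<in>{1..j}. C i)"

definition separator :: "(nat \<Rightarrow> 'v set) \<Rightarrow> nat \<Rightarrow> 'v set" where
  "separator C j = history C (j - 1) \<inter> C j"

definition perfect_order :: "'v rel \<Rightarrow> nat \<Rightarrow> (nat \<Rightarrow> 'v set) \<Rightarrow> bool" where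
  "perfect_order E r C \<longleftrightarrow>
     bij_betw C {1..r} (cliques E) \<and>
     (\<forall>j\<in>{2..r}. \<exists>i\<in>{1..<j}. separator C j \<subseteq> C i)"

text \<open>In a directed graph \<open>D\<close>, the pair \<open>(u, v)\<close> is the arrow from the parent \<open>u\<close> to \<open>v\<close>.\<close>

definition dag_version :: "'v rel \<Rightarrow> 'v rel \<Rightarrow> bool" where
  "dag_version E D \<longleftrightarrow> acyclic D \<and> D \<union> D\<inverse> = E - Id"

definition ancestral :: "'v rel \<Rightarrow> 'v set \<Rightarrow> bool" where
  "ancestral D A \<longleftrightarrow> (\<forall>v\<in>A. \<forall>u. (u, v) \<in> D \<longrightarrow> u \<in> A)"

definition induced_by :: "nat \<Rightarrow> (nat \<Rightarrow> 'v set) \<Rightarrow> 'v rel \<Rightarrow> bool" where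
  "induced_by r C D \<longleftrightarrow> (\<forall>j\<in>{1..<r}. ancestral D (history C j))"

definition num_ancestral_separators :: "nat \<Rightarrow> (nat \<Rightarrow> 'v set) \<Rightarrow> 'v rel \<Rightarrow> nat" where
  "num_ancestral_separators r C D = card {S \<in> separator C ` {2..r}. ancestral D S}"


section \<open>Matrices\<close>

definition pos_def :: "real^'v^'v \<Rightarrow> bool" where
  "pos_def A \<longleftrightarrow> transpose A = A \<and> (\<forall>x. x \<noteq> 0 \<longrightarrow> 0 < x \<bullet> (A *v x))"

definition P_G :: "'v::finite rel \<Rightarrow> (real^'v^'v) set" where
  "P_G E = {\<Omega>. pos_def \<Omega> \<and> (\<forall>i j. (i, j) \<notin> E \<longrightarrow> \<Omega> $ i $ j = 0)}"

definition PD_G :: "'v::finite rel \<Rightarrow> (real^'v^'v) set" where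
  "PD_G E = matrix_inv ` P_G E"

text \<open>An incomplete matrix is a function on the index pairs in \<open>E\<close>, extended by
  \<open>undefined\<close> outside \<open>E\<close>.\<close>

type_synonym 'v incomplete = "'v \<times> 'v \<Rightarrow> real"

definition restrict_matrix :: "'v::finite rel \<Rightarrow> real^'v^'v \<Rightarrow> 'v incomplete" where
  "restrict_matrix E A = restrict (\<lambda>(i, j). A $ i $ j) E"

definition Q_G :: "'v rel \<Rightarrow> 'v incomplete set" where
  "Q_G E = {\<Gamma> \<in> extensional E.
     (\<forall>(i, j)\<in>E. \<Gamma> (i, j) = \<Gamma> (j, i)) \<and>
     (\<forall>K\<in>cliques E. \<forall>x::'v \<Rightarrow> real. (\<exists>i\<in>K. x i \<noteq> 0) \<longrightarrow>
        0 < (\<Sum>i\<in>K. \<Sum>j\<in>K. x i * \<Gamma> (i, j) * x j))}"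

text \<open>For decomposable \<open>E\<close> and \<open>\<Gamma>\<close> in \<open>Q_G E\<close> the completion exists and is unique
  (Grone, Johnson, Sa and Wolkowicz), so the choice below is determined.\<close>

definition completion :: "'v::finite rel \<Rightarrow> 'v incomplete \<Rightarrow> real^'v^'v" where
  "completion E \<Gamma> = (SOME \<Sigma>. \<Sigma> \<in> PD_G E \<and> restrict_matrix E \<Sigma> = \<Gamma>)"

text \<open>The determinant of the principal submatrix with index set \<open>K\<close>, by the Leibniz formula;
  it is 1 for \<open>K = {}\<close>.\<close>

definition det_sub :: "'v incomplete \<Rightarrow> 'v set \<Rightarrow> real" where
  "det_sub \<Gamma> K = (\<Sum>p | p permutes K. of_int (sign p) * (\<Prod>i\<in>K. \<Gamma> (i, p i)))"

lemma det_sub_UNIV: "det_sub (\<lambda>(i, j). A $ i $ j) UNIV = det A"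
  by (simp add: det_sub_def det_def)

definition H_G ::
  "nat \<Rightarrow> (nat \<Rightarrow> 'v set) \<Rightarrow> (nat \<Rightarrow> real) \<Rightarrow> (nat \<Rightarrow> real) \<Rightarrow> 'v incomplete \<Rightarrow> real" where
  "H_G r C \<alpha> \<beta> \<Gamma> =
     (\<Prod>i\<in>{1..r}. det_sub \<Gamma> (C i) powr \<alpha> i) /
     (\<Prod>i\<in>{2..r}. det_sub \<Gamma> (separator C i) powr \<beta> i)"


section \<open>The measures on \<open>P_G\<close>\<close>

text \<open>Symmetric matrices vanishing off \<open>E\<close> have the entries \<open>\<Omega>\<^sub>i\<^sub>j = \<Omega>\<^sub>j\<^sub>i\<close>, one for each
  unordered edge \<open>{i, j}\<close> including the loops \<open>{i}\<close>, as free coordinates; Lebesgue measure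
  is taken with respect to these.\<close>

definition edge_sets :: "'v rel \<Rightarrow> 'v set set" where
  "edge_sets E = {{i, j} | i j. (i, j) \<in> E}"

definition sym_matrix :: "'v::finite rel \<Rightarrow> ('v set \<Rightarrow> real) \<Rightarrow> real^'v^'v" where
  "sym_matrix E x = (\<chi> i j. if (i, j) \<in> E then x {i, j} else 0)"

lemma measurable_sym_matrix:
  "sym_matrix E \<in> (\<Pi>\<^sub>M e\<in>edge_sets E. lborel) \<rightarrow>\<^sub>M borel"
proof -
  have "(\<lambda>x. sym_matrix E x \<bullet> axis i (axis j 1)) \<in> borel_measurable (\<Pi>\<^sub>M e\<in>edge_sets E. lborel)"
    for i j
  proof (cases "(i, j) \<in> E")
    case True
    then have "{i, j} \<in> edge_sets E"
      by (auto simp: edge_sets_def)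
    then have "(\<lambda>x. x {i, j}) \<in> (\<Pi>\<^sub>M e\<in>edge_sets E. lborel) \<rightarrow>\<^sub>M (lborel :: real measure)"
      by (rule measurable_component_singleton)
    then show ?thesis
      using True by (simp add: sym_matrix_def inner_axis)
  qed (simp add: sym_matrix_def inner_axis)
  then show ?thesis
    by (subst borel_measurable_euclidean_space) (auto simp: Basis_vec_def)
qed

definition lebesgue_P_G :: "'v::finite rel \<Rightarrow> (real^'v^'v) measure" where
  "lebesgue_P_G E =
     restrict_space (distr (\<Pi>\<^sub>M e\<in>edge_sets E. lborel) borel (sym_matrix E)) (P_G E)"

definition nu_G :: "'v::finite rel \<Rightarrow> nat \<Rightarrow> (nat \<Rightarrow> 'v set) \<Rightarrow> (real^'v^'v) measure" where
  "nu_G E r C = density (lebesgue_P_G E)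
     (\<lambda>\<Omega>. ennreal (H_G r C
        (\<lambda>i. (real (card (C i)) + 1) / 2) (\<lambda>i. (real (card (separator C i)) + 1) / 2)
        (restrict_matrix E (matrix_inv \<Omega>))))"

text \<open>The total mass of the measure
  \<open>exp (- trace (\<Omega> U)) H_G(\<alpha>, \<beta>, \<Omega>\<^sup>-\<^sup>E) \<nu>_G(d\<Omega>)\<close>, where \<open>U\<close> completes \<open>\<Gamma>\<close>.\<close>

definition omega_mass ::
  "'v::finite rel \<Rightarrow> nat \<Rightarrow> (nat \<Rightarrow> 'v set) \<Rightarrow> (nat \<Rightarrow> real) \<Rightarrow> (nat \<Rightarrow> real) \<Rightarrow>
   'v incomplete \<Rightarrow> ennreal" where
  "omega_mass E r C \<alpha> \<beta> \<Gamma> =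
     (\<integral>\<^sup>+ \<Omega>. ennreal (exp (- trace (\<Omega> ** completion E \<Gamma>)) *
              H_G r C \<alpha> \<beta> (restrict_matrix E (matrix_inv \<Omega>))) \<partial>nu_G E r C)"


section \<open>Parameter space and submanifolds\<close>

text \<open>Since \<open>r\<close> is not a type, \<open>\<real>\<^sup>r \<times> \<real>\<^sup>r\<^sup>-\<^sup>1\<close> is realised as a linear subspace of a Euclidean
  space whose coordinates are labelled by vertex sets: \<open>\<alpha>\<^sub>i\<close> is the coordinate of \<open>\<alpha>\<close> at the
  clique \<open>C i\<close>, for \<open>i\<close> in \<open>{1..r}\<close>, \<open>\<beta>\<^sub>i\<close> that of \<open>\<beta>\<close> at \<open>C i\<close>, for \<open>i\<close> in \<open>{2..r}\<close>, and
  the remaining coordinates vanish.\<close>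

definition param_space ::
  "nat \<Rightarrow> (nat \<Rightarrow> 'v::finite set) \<Rightarrow> ((real^('v set)) \<times> (real^('v set))) set" where
  "param_space r C = {(\<alpha>, \<beta>).
     (\<forall>K. K \<notin> C ` {1..r} \<longrightarrow> \<alpha> $ K = 0) \<and> (\<forall>K. K \<notin> C ` {2..r} \<longrightarrow> \<beta> $ K = 0)}"

definition finite_params ::
  "'v::finite rel \<Rightarrow> nat \<Rightarrow> (nat \<Rightarrow> 'v set) \<Rightarrow> ((real^('v set)) \<times> (real^('v set))) set" where
  "finite_params E r C = {(\<alpha>, \<beta>) \<in> param_space r C.
     \<forall>\<Gamma>\<in>Q_G E. omega_mass E r C (\<lambda>i. \<alpha> $ C i) (\<lambda>i. \<beta> $ C i) \<Gamma> < \<infinity>}"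

primrec times_differentiable_on ::
  "nat \<Rightarrow> 'a::euclidean_space set \<Rightarrow> ('a \<Rightarrow> 'b::euclidean_space) \<Rightarrow> bool" where
  "times_differentiable_on 0 U f \<longleftrightarrow> continuous_on U f"
| "times_differentiable_on (Suc n) U f \<longleftrightarrow>
     (\<forall>x\<in>U. f differentiable (at x)) \<and>
     (\<forall>v. times_differentiable_on n U (\<lambda>x. frechet_derivative f (at x) v))"

definition smooth_on :: "'a::euclidean_space set \<Rightarrow> ('a \<Rightarrow> 'b::euclidean_space) \<Rightarrow> bool" where
  "smooth_on U f \<longleftrightarrow> (\<forall>n. times_differentiable_on n U f)"

definition diffeo ::
  "'a::euclidean_space set \<Rightarrow> 'a set \<Rightarrow> ('a \<Rightarrow> 'a) \<Rightarrow> bool" where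
  "diffeo U V \<phi> \<longleftrightarrow> open U \<and> open V \<and> bij_betw \<phi> U V \<and>
     smooth_on U \<phi> \<and> smooth_on V (the_inv_into U \<phi>)"

text \<open>\<open>M\<close> is a nonempty embedded \<open>d\<close>-dimensional smooth submanifold of the linear space \<open>X\<close>:
  near each of its points a chart of \<open>X\<close> flattens \<open>M\<close> to a \<open>d\<close>-dimensional subspace.
  The charts of \<open>X\<close> are given as restrictions of diffeomorphisms of the surrounding Euclidean
  space that preserve \<open>X\<close>; locally, every diffeomorphism between open subsets of \<open>X\<close> arises
  in this way.\<close>

definition submanifold_of :: "'a::euclidean_space set \<Rightarrow> nat \<Rightarrow> 'a set \<Rightarrow> bool" where
  "submanifold_of X d M \<longleftrightarrow> M \<noteq> {} \<and> M \<subseteq> X \<and>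
     (\<forall>p\<in>M. \<exists>U V \<phi> W. p \<in> U \<and> diffeo U V \<phi> \<and> \<phi> ` (U \<inter> X) = V \<inter> X \<and>
        subspace W \<and> W \<subseteq> X \<and> dim W = d \<and> \<phi> ` (U \<inter> M) = V \<inter> W)"

end

theory Submission
  imports Defs "HOL-Probability.Distributions"
begin

text \<open>Every \<open>\<Omega>\<close> in \<open>P_G E\<close> is a sum \<open>\<Sum>v. l\<^sub>v L\<^sub>v L\<^sub>v\<^sup>T\<close> in which \<open>l\<^sub>v > 0\<close>, \<open>L\<^sub>v\<close> has entry 1 at \<open>v\<close>, and
  its other entries are supported on the parents of \<open>v\<close> in \<open>D\<close>. This holds because the histories
  are ancestral, so that the parents of a vertex lie in one clique and are pairwise adjacent
  (\<open>residual_parents\<close>). The number \<open>1 / l\<^sub>v\<close> is the conditional variance of \<open>v\<close> given its parents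
  under the covariance \<open>\<Sigma> = \<Omega>\<^sup>-\<^sup>1\<close>. Therefore the minor of \<open>\<Sigma>\<close> on an ancestral set is the product of
  the \<open>1 / l\<^sub>v\<close> over this set, and the minor on a clique \<open>C\<^sub>j\<close> is that on its separator \<open>S\<^sub>j\<close> times the
  \<open>1 / l\<^sub>v\<close> of the vertices new in \<open>C\<^sub>j\<close> (\<open>det_padded_factor\<close>).

  Absorb the exponents of \<open>\<nu>\<^sub>G\<close> into \<open>a\<^sub>j = \<alpha>\<^sub>j + (c\<^sub>j + 1) / 2\<close> and \<open>b\<^sub>j = \<beta>\<^sub>j + (s\<^sub>j + 1) / 2\<close>. The density
  then contains the minor on \<open>S\<^sub>j\<close> to the power \<open>a\<^sub>j - b\<^sub>j\<close>. If this power is 0 for every \<open>j\<close> with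
  \<open>S\<^sub>j\<close> not ancestral, only minors on ancestral separators remain, and the density is a monomial
  in the \<open>l\<^sub>v\<close> with exponents linear in \<open>a\<close> and \<open>b\<close> (\<open>H_G_product\<close>).

  As \<open>U\<close> is positive definite, \<open>trace (\<Omega> U) \<ge> m * (\<Sum>v. l\<^sub>v + \<bar>y\<^sub>v\<bar>\<^sup>2 / l\<^sub>v)\<close> for some \<open>m > 0\<close>, where \<open>y\<^sub>v\<close> is
  the part of \<open>l\<^sub>v L\<^sub>v\<close> on the parents of \<open>v\<close>. The \<open>l\<^sub>v\<close> and \<open>y\<^sub>v\<close> are the pivots and rows met when \<open>\<Omega>\<close> is
  reduced by symmetric Gaussian elimination, the children being eliminated before their parents.
  Each elimination step translates the remaining entries of \<open>\<Omega>\<close> by an amount that depends on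
  the eliminated row only. It thus preserves Lebesgue measure, and the integral of a product of
  functions of the \<open>(l\<^sub>v, y\<^sub>v)\<close> is a product of integrals, one for each vertex
  (\<open>elimination_weight_integral\<close>). Each of these is a Gaussian integral in \<open>y\<^sub>v\<close> followed by a
  Gamma integral in \<open>l\<^sub>v\<close>, and it is finite under a strict linear inequality on the exponents
  (\<open>star_weight_integral_finite\<close>).

  So all parameters in a set given by linear equations and strict linear inequalities have
  finite mass. The inequalities hold where \<open>a = 0\<close> and \<open>b = 0\<close>. There is one equation for each \<open>j\<close> in
  \<open>{2..r}\<close> with \<open>S\<^sub>j\<close> not ancestral, which leaves a relatively open piece of an affine subspace of
  dimension \<open>r\<close> plus the number of \<open>j\<close> with \<open>S\<^sub>j\<close> ancestral (\<open>dim_directions\<close>).\<close>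

section \<open>Perfect directed graphs and triangular factors\<close>

locale perfect_dag =
  fixes E D :: "'v::finite rel"
  assumes refl_E: "refl E"
    and acyclic_D: "acyclic D"
    and skeleton: "D \<union> D\<inverse> = E - Id"
    and parents_complete: "complete_in E {u. (u, v) \<in> D}"
begin

definition pa :: "'v \<Rightarrow> 'v set" where
  "pa v = {u. (u, v) \<in> D}"

text \<open>Regarded as the columns of a matrix whose indices are ordered compatibly with \<open>D\<close>, the \<open>L v\<close>
  form an upper unitriangular matrix.\<close>

definition unitriangular :: "('v \<Rightarrow> real^'v) \<Rightarrow> bool" where
  "unitriangular L \<longleftrightarrow> (\<forall>v. L v $ v = 1 \<and> (\<forall>u. u \<noteq> v \<and> u \<notin> pa v \<longrightarrow> L v $ u = 0))"

text \<open>This is \<open>L diag(l) L\<^sup>T\<close> for the matrix \<open>L\<close> with columns \<open>L v\<close>.\<close>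

definition gram :: "('v \<Rightarrow> real) \<Rightarrow> ('v \<Rightarrow> real^'v) \<Rightarrow> real^'v^'v" where
  "gram l L = (\<chi> i j. \<Sum>v\<in>UNIV. l v * (L v $ i * L v $ j))"

lemma wf_D: "wf D"
  by (rule finite_acyclic_wf[OF finite acyclic_D])

lemma wf_converse_D: "wf (D\<inverse>)"
  by (rule finite_acyclic_wf_converse[OF finite acyclic_D])

lemma not_self_parent: "v \<notin> pa v"
  using acyclic_D by (auto simp: pa_def acyclic_def)

lemma parent_adjacent: "u \<in> pa v \<Longrightarrow> (u, v) \<in> E \<and> (v, u) \<in> E"
  using skeleton by (auto simp: pa_def)

lemma adjacent_cases: "(u, v) \<in> E \<Longrightarrow> u = v \<or> u \<in> pa v \<or> v \<in> pa u"
  using skeleton by (auto simp: pa_def)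

lemma family_complete: "i \<in> insert v (pa v) \<Longrightarrow> j \<in> insert v (pa v) \<Longrightarrow> (i, j) \<in> E"
  using parents_complete[of v] parent_adjacent refl_E
  by (auto simp: complete_in_def pa_def refl_on_def)

lemma unitriangular_inner:
  assumes "unitriangular L" and "\<And>u. u \<in> pa v \<Longrightarrow> y $ u = 0"
  shows "L v \<bullet> y = y $ v"
proof -
  have "L v \<bullet> y = (\<Sum>u\<in>UNIV. L v $ u * y $ u)"
    by (simp add: inner_vec_def)
  also have "\<dots> = (\<Sum>u\<in>UNIV. if u = v then y $ v else 0)"
    using assms by (intro sum.cong) (auto simp: unitriangular_def)
  finally show ?thesis by simp
qed

text \<open>On an ancestral set the equations \<open>L u \<bullet> y = 0\<close> form a closed triangular system, which is solved
  from the sources of \<open>D\<close> onwards.\<close>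

lemma forward_substitution:
  assumes "unitriangular L" and "ancestral D A" and "\<And>u. u \<in> A \<Longrightarrow> L u \<bullet> y = 0" and "u \<in> A"
  shows "y $ u = 0"
  using \<open>u \<in> A\<close>
proof (induction u rule: wf_induct_rule[OF wf_D])
  case (1 u)
  then have "\<And>w. w \<in> pa u \<Longrightarrow> y $ w = 0"
    using assms(2) by (auto simp: pa_def ancestral_def)
  then show ?case
    using unitriangular_inner[OF assms(1), of u y] assms(3) 1 by auto
qed

text \<open>Component \<open>v\<close> of the sum involves only the column of \<open>v\<close> and those of its children, so the
  coefficients vanish successively from the sinks of \<open>D\<close> upwards.\<close>

lemma unitriangular_independent:
  assumes "unitriangular L" and "(\<Sum>v\<in>UNIV. c v *\<^sub>R L v) = 0"
  shows "c v = 0"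
proof (induction v rule: wf_induct_rule[OF wf_converse_D])
  case (1 v)
  have "0 = (\<Sum>w\<in>UNIV. c w *\<^sub>R L w) $ v"
    using assms(2) by simp
  also have "\<dots> = (\<Sum>w\<in>UNIV. c w * L w $ v)"
    by simp
  also have "\<dots> = (\<Sum>w\<in>UNIV. if w = v then c v else 0)"
  proof (intro sum.cong refl)
    fix w
    show "c w * L w $ v = (if w = v then c v else 0)"
      using assms(1) 1[of w] by (cases "w = v"; cases "(v, w) \<in> D") (auto simp: unitriangular_def pa_def)
  qed
  finally show ?case by simp
qed

lemma gram_mult: "gram l L *v z = (\<Sum>v\<in>UNIV. (l v * (L v \<bullet> z)) *\<^sub>R L v)"
proof -
  have "(gram l L *v z) $ i = (\<Sum>v\<in>UNIV. (l v * (L v \<bullet> z)) *\<^sub>R L v) $ i" for i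
  proof -
    have "(gram l L *v z) $ i = (\<Sum>j\<in>UNIV. \<Sum>v\<in>UNIV. l v * (L v $ i * L v $ j) * z $ j)"
      by (simp add: gram_def matrix_vector_mult_def sum_distrib_right)
    also have "\<dots> = (\<Sum>v\<in>UNIV. \<Sum>j\<in>UNIV. l v * (L v $ i * L v $ j) * z $ j)"
      by (rule sum.swap)
    also have "\<dots> = (\<Sum>v\<in>UNIV. (l v * (L v \<bullet> z)) *\<^sub>R L v) $ i"
      by (simp add: inner_vec_def sum_distrib_left sum_distrib_right mult_ac)
    finally show ?thesis .
  qed
  then show ?thesis by (simp add: vec_eq_iff)
qed

lemma gram_quadratic: "z \<bullet> (gram l L *v z) = (\<Sum>v\<in>UNIV. l v * (L v \<bullet> z)\<^sup>2)"
  unfolding gram_mult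
  by (simp add: inner_sum_right power2_eq_square inner_commute mult_ac)

lemma pos_def_gram:
  assumes "unitriangular L" and "\<And>v. 0 < l v"
  shows "pos_def (gram l L)"
  unfolding pos_def_def
proof (intro conjI allI impI)
  show "transpose (gram l L) = gram l L"
    by (simp add: transpose_def gram_def mult_ac)
  fix z :: "real^'v" assume "z \<noteq> 0"
  have "\<exists>v. L v \<bullet> z \<noteq> 0"
  proof (rule ccontr)
    assume "\<not> ?thesis"
    then have "z $ u = 0" for u
      using forward_substitution[OF assms(1), of UNIV z u] by (auto simp: ancestral_def)
    then show False
      using \<open>z \<noteq> 0\<close> by (simp add: vec_eq_iff)
  qed
  then obtain v where "L v \<bullet> z \<noteq> 0" by blast
  then have "0 < l v * (L v \<bullet> z)\<^sup>2"
    using assms(2) by simp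
  then show "0 < z \<bullet> (gram l L *v z)"
    unfolding gram_quadratic using assms(2)
    by (intro sum_pos2[of _ v]) (auto simp: less_imp_le)
qed

text \<open>Each summand lives on a vertex together with its parents, and such a set is complete; this is
  where perfectness of \<open>D\<close> gives the zero pattern.\<close>

lemma gram_in_P_G:
  assumes "unitriangular L" and "\<And>v. 0 < l v"
  shows "gram l L \<in> P_G E"
proof -
  have "gram l L $ i $ j = 0" if "(i, j) \<notin> E" for i j
  proof -
    have "L v $ i * L v $ j = 0" for v
      using family_complete[of i v j] that assms(1) by (auto simp: unitriangular_def)
    then have "l v * (L v $ i * L v $ j) = 0" for v
      by (metis mult_zero_right)
    then have "(\<Sum>v\<in>UNIV. l v * (L v $ i * L v $ j)) = 0"
      by (intro sum.neutral ballI)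
    then show ?thesis by (simp add: gram_def)
  qed
  then show ?thesis
    using pos_def_gram[OF assms] by (simp add: P_G_def)
qed

lemma trace_gram: "trace (gram l L ** U) = (\<Sum>v\<in>UNIV. l v * (L v \<bullet> (U *v L v)))"
proof -
  have "trace (gram l L ** U)
      = (\<Sum>i\<in>UNIV. \<Sum>k\<in>UNIV. \<Sum>v\<in>UNIV. l v * (L v $ i * L v $ k) * U $ k $ i)"
    by (simp add: trace_def matrix_matrix_mult_def gram_def sum_distrib_right)
  also have "\<dots> = (\<Sum>i\<in>UNIV. \<Sum>v\<in>UNIV. \<Sum>k\<in>UNIV. l v * (L v $ i * L v $ k) * U $ k $ i)"
    by (intro sum.cong refl sum.swap)
  also have "\<dots> = (\<Sum>v\<in>UNIV. \<Sum>i\<in>UNIV. \<Sum>k\<in>UNIV. l v * (L v $ i * L v $ k) * U $ k $ i)"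
    by (rule sum.swap)
  also have "\<dots> = (\<Sum>v\<in>UNIV. \<Sum>k\<in>UNIV. \<Sum>i\<in>UNIV. l v * (L v $ i * L v $ k) * U $ k $ i)"
    by (intro sum.cong refl sum.swap)
  also have "\<dots> = (\<Sum>v\<in>UNIV. l v * (L v \<bullet> (U *v L v)))"
    by (simp add: inner_vec_def matrix_vector_mult_def sum_distrib_left mult_ac)
  finally show ?thesis .
qed

end

lemma pos_def_inverse:
  fixes A :: "real^'v^'v"
  assumes "pos_def A"
  shows "A ** matrix_inv A = mat 1" and "matrix_inv A ** A = mat 1" and "invertible A"
proof -
  have "A *v x = 0 \<Longrightarrow> x = 0" for x
    using assms unfolding pos_def_def by (metis inner_zero_right less_irrefl)
  then show "invertible A"
    by (simp add: invertible_left_inverse matrix_left_invertible_ker)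
  then show "A ** matrix_inv A = mat 1" "matrix_inv A ** A = mat 1"
    unfolding invertible_def matrix_inv_def by (metis (mono_tags, lifting) someI_ex)+
qed

lemma pos_def_matrix_inv:
  fixes A :: "real^'v^'v"
  assumes "pos_def A"
  shows "pos_def (matrix_inv A)"
proof -
  note inv = pos_def_inverse[OF assms]
  have sym: "transpose A = A" using assms by (simp add: pos_def_def)
  have "transpose (matrix_inv A) ** A = mat 1"
    using inv(1) sym by (metis matrix_transpose_mul transpose_mat)
  then have tr: "transpose (matrix_inv A) = matrix_inv A"
    by (metis inv(1) matrix_mul_assoc matrix_mul_lid matrix_mul_rid)
  have "0 < x \<bullet> (matrix_inv A *v x)" if "x \<noteq> 0" for x
  proof -
    define y where "y = matrix_inv A *v x"
    have x: "x = A *v y"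
      by (simp add: y_def matrix_vector_mul_assoc inv)
    then have "y \<noteq> 0" using that by auto
    then have "0 < y \<bullet> (A *v y)" using assms by (simp add: pos_def_def)
    then show ?thesis by (simp add: y_def[symmetric] x[symmetric] inner_commute)
  qed
  then show ?thesis using tr by (simp add: pos_def_def)
qed

context perfect_dag begin

text \<open>The vectors \<open>l v *\<^sub>R y v\<close> form the dual basis of the columns \<open>L w\<close>. In particular \<open>y v\<close> is orthogonal
  to \<open>L w\<close> for all nondescendants \<open>w\<close> of \<open>v\<close>, which form an ancestral set, and so it vanishes on them.
  In statistical terms this is the Markov property of the covariance along \<open>D\<close>, and \<open>1 / l v\<close> is
  the conditional variance of \<open>v\<close> given its parents.\<close>

lemma inverse_gram_column:
  assumes "unitriangular L" and "\<And>v. 0 < l v"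
  defines "y \<equiv> \<lambda>v. matrix_inv (gram l L) *v L v"
  shows "(v, u) \<notin> D\<^sup>* \<Longrightarrow> y v $ u = 0" and "y v $ v = 1 / l v"
proof -
  have "gram l L *v y v = L v"
    using pos_def_inverse[OF pos_def_gram[OF assms(1,2)]]
    by (simp add: y_def matrix_vector_mul_assoc)
  then have "(\<Sum>w\<in>UNIV. (l w * (L w \<bullet> y v)) *\<^sub>R L w) = (\<Sum>w\<in>UNIV. (if w = v then 1 else 0) *\<^sub>R L w)"
    by (simp add: gram_mult if_distrib[where f="\<lambda>c. c *\<^sub>R _"] cong: if_cong)
  then have "(\<Sum>w\<in>UNIV. (l w * (L w \<bullet> y v) - (if w = v then 1 else 0)) *\<^sub>R L w) = 0"
    by (simp only: scaleR_diff_left sum_subtractf) simp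
  then have dual: "l w * (L w \<bullet> y v) = (if w = v then 1 else 0)" for w
    using unitriangular_independent[OF assms(1), of "\<lambda>w. l w * (L w \<bullet> y v) - (if w = v then 1 else 0)"]
    by simp
  have anc: "ancestral D {u. (v, u) \<notin> D\<^sup>*}"
    by (auto simp: ancestral_def intro: rtrancl_into_rtrancl)
  have zero: "y v $ u = 0" if "(v, u) \<notin> D\<^sup>*" for u
  proof (rule forward_substitution[OF assms(1) anc])
    fix w assume "w \<in> {u. (v, u) \<notin> D\<^sup>*}"
    then show "L w \<bullet> y v = 0"
      using dual[of w] assms(2)[of w] by (auto split: if_splits)
  qed (use that in auto)
  show "(v, u) \<notin> D\<^sup>* \<Longrightarrow> y v $ u = 0" by (rule zero)
  have "(v, u) \<notin> D\<^sup>*" if "u \<in> pa v" for u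
    using that acyclic_D by (auto simp: pa_def acyclic_def dest: rtrancl_into_trancl1)
  then have "L v \<bullet> y v = y v $ v"
    by (intro unitriangular_inner[OF assms(1)] zero)
  then show "y v $ v = 1 / l v"
    using dual[of v] assms(2)[of v] by (simp add: field_simps)
qed

end

section \<open>Determinants of principal submatrices\<close>

text \<open>Completing the principal submatrix on \<open>K\<close> by an identity block keeps its determinant and makes it
  a matrix on the full index type, so that row operations can be applied to it.\<close>

definition padded :: "real^'v^'v \<Rightarrow> 'v set \<Rightarrow> real^'v^'v" where
  "padded A K = (\<chi> i j. if i \<in> K \<and> j \<in> K then A $ i $ j else if i = j then 1 else 0)"

lemma det_sub_restrict_matrix:
  fixes A :: "real^'v::finite^'v"
  assumes "complete_in E K"
  shows "det_sub (restrict_matrix E A) K = det (padded A K)"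
proof -
  \<comment> \<open>A permutation that moves an index outside \<open>K\<close> meets an entry 0 of the identity block.\<close>
  have zero: "(\<Prod>i\<in>UNIV. padded A K $ i $ p i) = 0" if "p permutes UNIV" "\<not> p permutes K" for p
  proof -
    have "\<exists>i. i \<notin> K \<and> p i \<noteq> i"
      using that permutes_superset[of p UNIV K] by auto
    then obtain i where "i \<notin> K" "p i \<noteq> i" by blast
    then have "padded A K $ i $ p i = 0" by (auto simp: padded_def)
    then show ?thesis by (meson UNIV_I finite prod_zero)
  qed
  have "det (padded A K) = (\<Sum>p | p permutes UNIV. of_int (sign p) * (\<Prod>i\<in>UNIV. padded A K $ i $ p i))"
    by (simp add: det_def)
  also have "\<dots> = (\<Sum>p | p permutes K. of_int (sign p) * (\<Prod>i\<in>UNIV. padded A K $ i $ p i))"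
    using zero by (intro sum.mono_neutral_right) (auto intro: permutes_subset simp: finite_permutations)
  also have "\<dots> = (\<Sum>p | p permutes K. of_int (sign p) * (\<Prod>i\<in>K. restrict_matrix E A (i, p i)))"
  proof (intro sum.cong refl arg_cong2[where f="(*)"])
    fix p assume "p \<in> {p. p permutes K}"
    then have p: "p permutes K" by simp
    have "(\<Prod>i\<in>UNIV. padded A K $ i $ p i) = (\<Prod>i\<in>K. padded A K $ i $ p i)"
      using permutes_not_in[OF p] by (intro prod.mono_neutral_right) (auto simp: padded_def)
    also have "\<dots> = (\<Prod>i\<in>K. restrict_matrix E A (i, p i))"
      using assms permutes_in_image[OF p]
      by (intro prod.cong) (auto simp: padded_def restrict_matrix_def complete_in_def)
    finally show "(\<Prod>i\<in>UNIV. padded A K $ i $ p i) = (\<Prod>i\<in>K. restrict_matrix E A (i, p i))" .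
  qed
  finally show ?thesis by (simp add: det_sub_def)
qed

text \<open>If row \<open>v\<close> is supported on the diagonal, then column \<open>v\<close> matters only there: a permutation that
  moves \<open>v\<close> picks an entry 0 of row \<open>v\<close>.\<close>

lemma det_unit_row_cong:
  fixes A B :: "real^'v::finite^'v"
  assumes "\<And>j. j \<noteq> v \<Longrightarrow> A $ v $ j = 0" "\<And>j. j \<noteq> v \<Longrightarrow> B $ v $ j = 0"
    and "A $ v $ v = B $ v $ v"
    and "\<And>i j. i \<noteq> v \<Longrightarrow> j \<noteq> v \<Longrightarrow> A $ i $ j = B $ i $ j"
  shows "det A = det B"
  unfolding det_def
proof (intro sum.cong refl arg_cong2[where f="(*)"])
  fix p assume "p \<in> {p. p permutes (UNIV :: 'v set)}"
  then have p: "p permutes UNIV" by simp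
  show "(\<Prod>i\<in>UNIV. A $ i $ p i) = (\<Prod>i\<in>UNIV. B $ i $ p i)"
  proof (cases "p v = v")
    case True
    then have "p i \<noteq> v" if "i \<noteq> v" for i
      using permutes_inj[OF p] that by (metis injD)
    then have "A $ i $ p i = B $ i $ p i" for i
      using True assms(3,4) by (cases "i = v") auto
    then show ?thesis by simp
  next
    case False
    then have "A $ v $ p v = 0" "B $ v $ p v = 0"
      using assms(1,2) by auto
    then have "(\<Prod>i\<in>UNIV. A $ i $ p i) = 0" "(\<Prod>i\<in>UNIV. B $ i $ p i) = 0"
      by (meson UNIV_I finite prod_zero)+
    then show ?thesis by (simp only:)
  qed
qed

text \<open>Replace row \<open>v\<close> by the combination of rows with coefficients \<open>b\<close>. As \<open>b $ v = 1\<close>, the determinant is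
  unchanged, while the new row is \<open>d\<close> times a unit vector.\<close>

lemma det_padded_insert:
  fixes S :: "real^'v::finite^'v"
  assumes "transpose S = S" and "v \<notin> K" and "b $ v = 1"
    and "\<And>u. u \<notin> insert v K \<Longrightarrow> b $ u = 0"
    and "\<And>u. u \<in> K \<Longrightarrow> (S *v b) $ u = 0" and "(S *v b) $ v = d"
  shows "det (padded S (insert v K)) = d * det (padded S K)"
proof -
  define A where "A = padded S (insert v K)"
  have comb: "(\<Sum>i\<in>UNIV. b $ i *s row i A) = d *s axis v 1"
  proof -
    have "(\<Sum>i\<in>UNIV. b $ i * A $ i $ j) = d * axis v 1 $ j" for j
    proof (cases "j \<in> insert v K")
      case True
      have "S $ i $ j = S $ j $ i" for i
        using assms(1) by (metis transpose_def vec_lambda_beta)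
      then have "(\<Sum>i\<in>UNIV. b $ i * A $ i $ j) = (\<Sum>i\<in>UNIV. S $ j $ i * b $ i)"
        using True assms(4) by (intro sum.cong) (auto simp: A_def padded_def)
      also have "\<dots> = (S *v b) $ j"
        by (simp add: matrix_vector_mult_def)
      also have "\<dots> = d * axis v 1 $ j"
        using True assms(2,5,6) by (auto simp: axis_def)
      finally show ?thesis .
    next
      case False
      then have "b $ i * A $ i $ j = 0" for i
        using assms(4)[of i] by (cases "i \<in> insert v K") (auto simp: A_def padded_def)
      then have "(\<Sum>i\<in>UNIV. b $ i * A $ i $ j) = 0"
        by (intro sum.neutral ballI)
      then show ?thesis
        using False by (auto simp: axis_def)
    qed
    then show ?thesis
      by (simp add: vec_eq_iff row_def)
  qed
  have "det A = det (\<chi> i. if i = v then (\<Sum>i\<in>UNIV. b $ i *s row i A) else row i A)"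
    using cramer_lemma_transpose[of v b A] assms(3) by simp
  also have "\<dots> = det (\<chi> i. if i = v then d *s axis v 1 else row i A)"
    unfolding comb ..
  also have "\<dots> = d * det (\<chi> i. if i = v then axis v 1 else row i A)"
    using det_row_mul[of v d "\<lambda>_. axis v 1" "\<lambda>i. row i A"] by simp
  also have "det (\<chi> i. if i = v then axis v 1 else row i A) = det (padded S K)"
    using assms(2) by (intro det_unit_row_cong[of v]) (auto simp: axis_def row_def A_def padded_def)
  finally show ?thesis by (simp add: A_def)
qed

lemma det_padded_empty: "det (padded S {}) = 1"
proof -
  have "padded S {} = mat 1" by (simp add: padded_def mat_def vec_eq_iff)
  then show ?thesis by simp
qed

text \<open>The constant is the minimum of the quadratic form on the unit sphere.\<close>

lemma pos_def_coercive:
  fixes U :: "real^'v::finite^'v"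
  assumes "pos_def U"
  shows "\<exists>m>0. \<forall>x. m * (x \<bullet> x) \<le> x \<bullet> (U *v x)"
proof -
  have cont: "continuous_on (sphere 0 1) (\<lambda>x. x \<bullet> (U *v x))"
    by (intro continuous_intros linear_continuous_on_compose[of _ _ "(*v) U"]) auto
  obtain x0 :: "real^'v" where x0: "x0 \<in> sphere 0 1"
    and min: "\<And>x. x \<in> sphere 0 1 \<Longrightarrow> x0 \<bullet> (U *v x0) \<le> x \<bullet> (U *v x)"
    using continuous_attains_inf[OF compact_sphere _ cont] by (auto simp del: mem_sphere)
  have "0 < x0 \<bullet> (U *v x0)"
    using assms x0 unfolding pos_def_def
    by (metis mem_sphere_0 norm_zero zero_neq_one)
  moreover have "x0 \<bullet> (U *v x0) * (x \<bullet> x) \<le> x \<bullet> (U *v x)" for x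
  proof (cases "x = 0")
    case False
    have "x0 \<bullet> (U *v x0) \<le> (x /\<^sub>R norm x) \<bullet> (U *v (x /\<^sub>R norm x))"
      using False by (intro min) simp
    also have "\<dots> = (x \<bullet> (U *v x)) / (norm x)\<^sup>2"
      by (simp add: matrix_vector_mult_scaleR power2_eq_square divide_inverse)
    finally show ?thesis
      using False by (simp add: field_simps power2_norm_eq_inner)
  qed simp
  ultimately show ?thesis by blast
qed

section \<open>Positive definite completion and factorisation of minors\<close>

lemma complete_subset_clique:
  fixes E :: "'v::finite rel"
  assumes "complete_in E A"
  obtains K where "K \<in> cliques E" "A \<subseteq> K"
proof -
  obtain K where "complete_in E K" "A \<subseteq> K" "\<And>B. complete_in E B \<Longrightarrow> K \<subseteq> B \<Longrightarrow> B = K"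
    using finite_has_maximal2[of "{B. complete_in E B}" A] assms by auto
  then have "K \<in> cliques E" by (auto simp: cliques_def)
  with \<open>A \<subseteq> K\<close> show ?thesis by (rule that[rotated])
qed

lemma Q_G_complete_positive:
  fixes E :: "'v::finite rel"
  assumes "G \<in> Q_G E" and "complete_in E A" and "i \<in> A" "x i \<noteq> 0"
  shows "0 < (\<Sum>i\<in>A. \<Sum>j\<in>A. x i * G (i, j) * x j)"
proof -
  obtain K where K: "K \<in> cliques E" "A \<subseteq> K"
    using complete_subset_clique[OF assms(2)] by blast
  define y where "y = (\<lambda>i. if i \<in> A then x i else 0)"
  have "0 < (\<Sum>i\<in>K. \<Sum>j\<in>K. y i * G (i, j) * y j)"
  proof -
    have "\<exists>i\<in>K. y i \<noteq> 0" using assms K by (auto simp: y_def)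
    then show ?thesis using assms(1) K(1) unfolding Q_G_def by blast
  qed
  also have "\<dots> = (\<Sum>i\<in>A. \<Sum>j\<in>K. y i * G (i, j) * y j)"
    using K by (intro sum.mono_neutral_right) (auto simp: y_def)
  also have "\<dots> = (\<Sum>i\<in>A. \<Sum>j\<in>A. y i * G (i, j) * y j)"
    using K by (intro sum.cong refl sum.mono_neutral_right) (auto simp: y_def)
  also have "\<dots> = (\<Sum>i\<in>A. \<Sum>j\<in>A. x i * G (i, j) * x j)"
    by (intro sum.cong) (auto simp: y_def)
  finally show ?thesis .
qed

context perfect_dag begin

text \<open>The vector \<open>b\<close> is the residual of the regression of \<open>v\<close> on its parents. The normal equations are
  solvable because the parents form a complete set, on which \<open>G\<close> is positive definite. The last
  quantity is the residual variance, the value of the quadratic form at \<open>b\<close>.\<close>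

lemma regression:
  assumes "G \<in> Q_G E"
  shows "\<exists>b::real^'v. b $ v = 1 \<and> (\<forall>u. u \<noteq> v \<and> u \<notin> pa v \<longrightarrow> b $ u = 0) \<and>
    (\<forall>u\<in>pa v. (\<Sum>j\<in>insert v (pa v). G (u, j) * b $ j) = 0) \<and>
    0 < (\<Sum>j\<in>insert v (pa v). G (v, j) * b $ j)"
proof -
  \<comment> \<open>The submatrix on the parents, completed by an identity block.\<close>
  define P :: "real^'v^'v" where
    "P = (\<chi> i j. if i \<in> pa v \<and> j \<in> pa v then G (i, j) else if i = j then 1 else 0)"
  have P_in: "(P *v x) $ i = (\<Sum>j\<in>pa v. G (i, j) * x $ j)" if "i \<in> pa v" for x i
  proof -
    have "(P *v x) $ i = (\<Sum>j\<in>UNIV. if j \<in> pa v then G (i, j) * x $ j else 0)"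
      unfolding matrix_vector_mult_def P_def using that by (auto intro!: sum.cong)
    then show ?thesis by (simp add: sum.If_cases)
  qed
  have P_out: "(P *v x) $ i = x $ i" if "i \<notin> pa v" for x i
  proof -
    have "(P *v x) $ i = (\<Sum>j\<in>UNIV. if j = i then x $ i else 0)"
      unfolding matrix_vector_mult_def P_def vec_lambda_beta using that by (intro sum.cong) auto
    then show ?thesis by simp
  qed
  have complete: "complete_in E (insert v (pa v))" "complete_in E (pa v)"
    using family_complete[of _ v] by (auto simp: complete_in_def)
  have "x = 0" if "P *v x = 0" for x
  proof (rule ccontr)
    assume "x \<noteq> 0"
    then obtain i where i: "x $ i \<noteq> 0" by (auto simp: vec_eq_iff)
    then have "i \<in> pa v" using P_out[of i x] that by auto
    then have "0 < (\<Sum>i\<in>pa v. \<Sum>j\<in>pa v. x $ i * G (i, j) * x $ j)"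
      using Q_G_complete_positive[OF assms complete(2), of i "($) x"] i by simp
    also have "\<dots> = (\<Sum>i\<in>pa v. x $ i * (P *v x) $ i)"
      by (intro sum.cong refl) (simp add: P_in sum_distrib_left mult_ac)
    finally show False using that by simp
  qed
  then have "invertible P"
    by (simp add: invertible_left_inverse matrix_left_invertible_ker)
  then obtain B where B: "P ** B = mat 1" by (auto simp: invertible_def)
  define c where "c = B *v (\<chi> u. if u \<in> pa v then G (u, v) else 0)"
  have Pc: "P *v c = (\<chi> u. if u \<in> pa v then G (u, v) else 0)"
    by (simp add: c_def matrix_vector_mul_assoc B)
  define b where "b = axis v 1 - c"
  have b_v: "b $ v = 1"
    using P_out[OF not_self_parent, of c] not_self_parent[of v] by (simp add: b_def Pc)
  have b_out: "b $ u = 0" if "u \<noteq> v" "u \<notin> pa v" for u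
    using P_out[of u c] that by (simp add: b_def Pc axis_def)
  have b_pa: "b $ u = - c $ u" if "u \<in> pa v" for u
    using that not_self_parent[of v] by (auto simp: b_def axis_def)
  have orth: "(\<Sum>j\<in>insert v (pa v). G (u, j) * b $ j) = 0" if "u \<in> pa v" for u
    using that P_in[of u c] by (simp add: not_self_parent b_v b_pa Pc sum_negf)
  have "0 < (\<Sum>i\<in>insert v (pa v). \<Sum>j\<in>insert v (pa v). b $ i * G (i, j) * b $ j)"
    using Q_G_complete_positive[OF assms complete(1), of v "($) b"] b_v by simp
  also have "\<dots> = (\<Sum>i\<in>insert v (pa v). b $ i * (\<Sum>j\<in>insert v (pa v). G (i, j) * b $ j))"
    by (simp only: sum_distrib_left mult.assoc)
  also have "\<dots> = (\<Sum>j\<in>insert v (pa v). G (v, j) * b $ j)"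
    using orth by (subst sum.insert) (simp_all add: not_self_parent b_v)
  finally show ?thesis using b_v b_out orth by blast
qed

text \<open>The residual vectors and residual variances of \<open>G\<close> are taken as the triangular factor of the
  inverse of the completion. By \<open>inverse_gram_column\<close> the completion satisfies the same regression
  equations as \<open>G\<close>. These determine its entries in column \<open>v\<close> from the entries between parents of
  \<open>v\<close>, so agreement with \<open>G\<close> follows by induction along \<open>D\<close>.\<close>

lemma completion_exists:
  assumes "G \<in> Q_G E"
  shows "\<exists>S. S \<in> PD_G E \<and> restrict_matrix E S = G"
proof -
  obtain L :: "'v \<Rightarrow> real^'v" where L:
    "\<And>v. L v $ v = 1" "\<And>v u. u \<noteq> v \<Longrightarrow> u \<notin> pa v \<Longrightarrow> L v $ u = 0"
    "\<And>v u. u \<in> pa v \<Longrightarrow> (\<Sum>j\<in>insert v (pa v). G (u, j) * L v $ j) = 0"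
    "\<And>v. 0 < (\<Sum>j\<in>insert v (pa v). G (v, j) * L v $ j)"
  proof -
    have "\<exists>L::'v \<Rightarrow> real^'v. \<forall>v. L v $ v = 1 \<and> (\<forall>u. u \<noteq> v \<and> u \<notin> pa v \<longrightarrow> L v $ u = 0) \<and>
        (\<forall>u\<in>pa v. (\<Sum>j\<in>insert v (pa v). G (u, j) * L v $ j) = 0) \<and>
        0 < (\<Sum>j\<in>insert v (pa v). G (v, j) * L v $ j)"
      using regression[OF assms] by (intro choice allI)
    then obtain L :: "'v \<Rightarrow> real^'v" where "\<forall>v. L v $ v = 1 \<and> (\<forall>u. u \<noteq> v \<and> u \<notin> pa v \<longrightarrow> L v $ u = 0) \<and>
        (\<forall>u\<in>pa v. (\<Sum>j\<in>insert v (pa v). G (u, j) * L v $ j) = 0) \<and>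
        0 < (\<Sum>j\<in>insert v (pa v). G (v, j) * L v $ j)" ..
    then show ?thesis using that by blast
  qed
  define d where "d v = (\<Sum>j\<in>insert v (pa v). G (v, j) * L v $ j)" for v
  have uni: "unitriangular L" using L by (simp add: unitriangular_def)
  define l where "l v = 1 / d v" for v
  have pos: "0 < l v" for v using L(4) by (simp add: l_def d_def)
  define S where "S = matrix_inv (gram l L)"
  have "pos_def S"
    unfolding S_def by (intro pos_def_matrix_inv pos_def_gram uni pos)
  then have "transpose S = S" by (simp add: pos_def_def)
  then have S_sym: "S $ i $ j = S $ j $ i" for i j
    by (metis transpose_def vec_lambda_beta)
  have G_sym: "G (i, j) = G (j, i)" if "(i, j) \<in> E" for i j
    using assms that by (auto simp: Q_G_def)
  have S_L: "(S *v L v) $ u = (\<Sum>j\<in>insert v (pa v). S $ u $ j * L v $ j)" for u v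
    unfolding matrix_vector_mult_def using L(2) by (simp, intro sum.mono_neutral_right) auto
  have agree: "S $ v $ v = G (v, v) \<and> (\<forall>u\<in>pa v. S $ u $ v = G (u, v))" for v
  proof (induction v rule: wf_induct_rule[OF wf_D])
    case (1 v)
    have old: "S $ u $ w = G (u, w)" if "u \<in> pa v" "w \<in> pa v" for u w
    proof -
      have "(u, w) \<in> E" using family_complete that by blast
      then consider "u = w" | "u \<in> pa w" | "w \<in> pa u" using adjacent_cases by blast
      then show ?thesis
        using 1[of u] 1[of w] that S_sym G_sym[OF \<open>(u, w) \<in> E\<close>] by cases (auto simp: pa_def)
    qed
    have new: "S $ u $ v = G (u, v)" if "u \<in> pa v" for u
    proof -
      have "(v, u) \<notin> D\<^sup>*"
        using that acyclic_D by (auto simp: pa_def acyclic_def dest: rtrancl_into_trancl1)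
      then have "(\<Sum>j\<in>insert v (pa v). S $ u $ j * L v $ j) = 0"
        using inverse_gram_column(1)[where l=l, OF uni pos \<open>(v, u) \<notin> D\<^sup>*\<close>] unfolding S_L[symmetric] by (simp add: S_def)
      then show ?thesis
        using L(3)[OF that] that by (simp add: not_self_parent L(1) old)
    qed
    have "(\<Sum>j\<in>insert v (pa v). S $ v $ j * L v $ j) = d v"
      using inverse_gram_column(2)[where l=l, OF uni pos, of v] unfolding S_L[symmetric] by (simp add: l_def S_def)
    moreover have "(\<Sum>j\<in>pa v. S $ v $ j * L v $ j) = (\<Sum>j\<in>pa v. G (v, j) * L v $ j)"
      using new S_sym[of v] G_sym parent_adjacent by (intro sum.cong) auto
    ultimately have "S $ v $ v = G (v, v)"
      by (simp add: d_def not_self_parent L(1))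
    with new show ?case by blast
  qed
  have "S $ i $ j = G (i, j)" if "(i, j) \<in> E" for i j
    using adjacent_cases[OF that] agree[of i] agree[of j] S_sym[of i j] G_sym[OF that] by auto
  then have "restrict_matrix E S = G"
    using assms by (auto simp: restrict_matrix_def Q_G_def extensional_def restrict_def fun_eq_iff)
  moreover have "S \<in> PD_G E"
    unfolding PD_G_def S_def by (intro imageI gram_in_P_G uni pos)
  ultimately show ?thesis by blast
qed

lemma pos_def_completion:
  assumes "G \<in> Q_G E"
  shows "pos_def (completion E G)"
proof -
  have "completion E G \<in> PD_G E"
    unfolding completion_def using someI_ex[OF completion_exists[OF assms]] by blast
  then show ?thesis
    by (auto simp: PD_G_def P_G_def intro: pos_def_matrix_inv)
qed

text \<open>Build up \<open>K\<close> from \<open>K0\<close> by adding vertices one at a time, parents first. The hypotheses ensure that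
  a vertex is added after its parents and before all its descendants in \<open>K\<close>, so by \<open>det_padded_insert\<close> and
  \<open>inverse_gram_column\<close> it multiplies the minor by its conditional variance.\<close>

lemma det_padded_factor:
  assumes "unitriangular L" and "\<And>v. 0 < l v"
    and "K0 \<subseteq> K" and "\<And>v. v \<in> K - K0 \<Longrightarrow> pa v \<subseteq> K"
    and "\<And>v u. v \<in> K - K0 \<Longrightarrow> u \<in> K0 \<Longrightarrow> (v, u) \<notin> D\<^sup>*"
  defines "S \<equiv> matrix_inv (gram l L)"
  shows "det (padded S K) = det (padded S K0) * (\<Prod>v\<in>K - K0. 1 / l v)"
  using assms(3-5)
proof (induction "card (K - K0)" arbitrary: K)
  case 0
  then have "K = K0" by auto
  then show ?case by simp
next
  case (Suc n)
  have "wf ((D\<inverse>)\<^sup>+)" using wf_converse_D by (rule wf_trancl)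
  moreover obtain v0 where "v0 \<in> K - K0"
    using Suc.hyps(2) by (metis card.empty equals0I nat.distinct(1))
  ultimately obtain v where v: "v \<in> K - K0"
    and "\<And>y. (y, v) \<in> (D\<inverse>)\<^sup>+ \<Longrightarrow> y \<notin> K - K0"
    by (rule wfE_min) blast
  then have last: "\<And>y. (v, y) \<in> D\<^sup>+ \<Longrightarrow> y \<notin> K - K0"
    by (simp add: trancl_converse)
  have diff: "K - {v} - K0 = K - K0 - {v}" by auto
  have "det (padded S (K - {v})) = det (padded S K0) * (\<Prod>v\<in>K - {v} - K0. 1 / l v)"
  proof (rule Suc.hyps(1))
    show "n = card (K - {v} - K0)"
      using v Suc.hyps(2) by (simp add: diff)
    show "pa w \<subseteq> K - {v}" if "w \<in> K - {v} - K0" for w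
    proof -
      have "(v, w) \<notin> D" using last[of w] that by blast
      then show ?thesis using Suc.prems(2)[of w] that by (auto simp: pa_def)
    qed
  qed (use Suc.prems v in auto)
  moreover have "det (padded S (insert v (K - {v}))) = 1 / l v * det (padded S (K - {v}))"
  proof (rule det_padded_insert[of S v _ "L v"])
    have "pos_def S" unfolding S_def by (intro pos_def_matrix_inv pos_def_gram assms(1,2))
    then show "transpose S = S" by (simp add: pos_def_def)
    show "L v $ v = 1" "\<And>u. u \<notin> insert v (K - {v}) \<Longrightarrow> L v $ u = 0"
      using assms(1) Suc.prems(2)[OF v] by (auto simp: unitriangular_def)
    fix u assume u: "u \<in> K - {v}"
    have "(v, u) \<notin> D\<^sup>*"
      using u last[of u] Suc.prems(3)[OF v, of u] by (auto simp: rtrancl_eq_or_trancl)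
    then show "(S *v L v) $ u = 0"
      unfolding S_def by (rule inverse_gram_column(1)[OF assms(1,2)])
  qed (auto simp: S_def inverse_gram_column(2)[OF assms(1,2)])
  moreover have "insert v (K - {v}) = K" using v by auto
  moreover have "(\<Prod>v\<in>K - K0. 1 / l v) = 1 / l v * (\<Prod>v\<in>K - K0 - {v}. 1 / l v)"
    using v by (intro prod.remove) auto
  ultimately show ?case by (simp add: diff)
qed

end

section \<open>Gaussian and Gamma integrals\<close>

lemma emeasure_lborel_translate:
  fixes c :: real
  assumes "A \<in> sets borel"
  shows "emeasure lborel {t. t - c \<in> A} = emeasure lborel A"
proof -
  have "emeasure lborel A = emeasure (distr lborel borel ((+) (- c))) A"
    by (simp add: lborel_distr_plus)
  also have "\<dots> = emeasure lborel {t. t - c \<in> A}"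
    using assms by (subst emeasure_distr) (auto intro!: arg_cong[where f="emeasure lborel"] simp: vimage_def)
  finally show ?thesis by simp
qed

lemma nn_integral_PiM_lborel_translate:
  fixes c :: "'i \<Rightarrow> real"
  assumes [simp]: "finite I" and [measurable]: "f \<in> borel_measurable (\<Pi>\<^sub>M e\<in>I. lborel)"
  shows "(\<integral>\<^sup>+y. f (\<lambda>e\<in>I. y e - c e) \<partial>(\<Pi>\<^sub>M e\<in>I. lborel)) = (\<integral>\<^sup>+y. f y \<partial>(\<Pi>\<^sub>M e\<in>I. lborel))"
proof -
  interpret product_sigma_finite "\<lambda>e. lborel :: real measure" by standard
  interpret fin: finite_product_sigma_finite "\<lambda>e. lborel :: real measure" I by standard simp
  let ?M = "\<Pi>\<^sub>M e\<in>I. (lborel :: real measure)"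
  let ?T = "\<lambda>y. \<lambda>e\<in>I. y e - c e"
  have [measurable]: "?T \<in> ?M \<rightarrow>\<^sub>M ?M" by measurable
  have "distr ?M ?M ?T = ?M"
  proof (rule PiM_eqI)
    fix A :: "'i \<Rightarrow> real set" assume A: "\<And>e. e \<in> I \<Longrightarrow> A e \<in> sets lborel"
    have "?T -` Pi\<^sub>E I A \<inter> space ?M = Pi\<^sub>E I (\<lambda>e. {t. t - c e \<in> A e})"
      by (auto simp: space_PiM PiE_iff Pi_iff)
    then have "emeasure (distr ?M ?M ?T) (Pi\<^sub>E I A) = emeasure ?M (Pi\<^sub>E I (\<lambda>e. {t. t - c e \<in> A e}))"
      using A by (subst emeasure_distr) (auto intro!: sets_PiM_I_finite)
    also have "\<dots> = (\<Prod>e\<in>I. emeasure lborel {t. t - c e \<in> A e})"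
    proof (rule fin.measure_times)
      fix e assume "e \<in> I"
      then have [measurable]: "A e \<in> sets borel" using A by simp
      show "{t. t - c e \<in> A e} \<in> sets lborel" by measurable
    qed
    also have "\<dots> = (\<Prod>e\<in>I. emeasure lborel (A e))"
      using A by (intro prod.cong refl emeasure_lborel_translate) simp
    finally show "emeasure (distr ?M ?M ?T) (Pi\<^sub>E I A) = (\<Prod>e\<in>I. emeasure lborel (A e))" .
  qed simp_all
  then have "(\<integral>\<^sup>+y. f y \<partial>?M) = (\<integral>\<^sup>+y. f y \<partial>distr ?M ?M ?T)" by simp
  also have "\<dots> = (\<integral>\<^sup>+y. f (?T y) \<partial>?M)" by (rule nn_integral_distr) measurable
  finally show ?thesis by simp
qed

text \<open>The integrand is a multiple of the normal density with variance \<open>1 / (2 * a)\<close>.\<close>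

lemma nn_integral_gaussian:
  fixes a :: real
  assumes "0 < a"
  shows "(\<integral>\<^sup>+y. ennreal (exp (- a * y\<^sup>2)) \<partial>lborel) = ennreal (sqrt (pi / a))"
proof -
  define s where "s = sqrt (1 / (2 * a))"
  have s2: "s\<^sup>2 = 1 / (2 * a)" and s: "0 < s" using assms by (auto simp: s_def)
  interpret prob_space "density lborel (normal_density 0 s)"
    by (rule prob_space_normal_density) (fact s)
  have dens: "exp (- a * y\<^sup>2) = sqrt (pi / a) * normal_density 0 s y" for y
    using assms by (simp add: normal_density_def s2)
  have "(\<integral>\<^sup>+y. ennreal (normal_density 0 s y) \<partial>lborel) = 1"
    using emeasure_space_1 by (simp add: emeasure_density)
  then show ?thesis
    unfolding dens using assms by (simp add: ennreal_mult' nn_integral_cmult)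
qed

lemma nn_integral_gamma_finite:
  fixes a m :: real
  assumes "-1 < a" and "0 < m"
  shows "(\<integral>\<^sup>+t. ennreal (if 0 < t then t powr a * exp (- m * t) else 0) \<partial>lborel) < \<infinity>"
proof -
  define f where "f = (\<lambda>t::real. indicator {0..} t * t powr a / exp t)"
  have f_meas [measurable]: "f \<in> borel_measurable borel" unfolding f_def by measurable
  have "ennreal (Gamma (a + 1)) = (\<integral>\<^sup>+t. ennreal (f t) \<partial>lborel)"
    using Gamma_conv_nn_integral_real[of "a + 1"] assms by (simp only: add_diff_cancel_right' f_def)
  also have "\<dots> = ennreal \<bar>m\<bar> * (\<integral>\<^sup>+t. ennreal (f (0 + m * t)) \<partial>lborel)"
    using assms by (intro nn_integral_real_affine) auto
  finally have "ennreal (Gamma (a + 1)) = ennreal m * (\<integral>\<^sup>+t. ennreal (f (m * t)) \<partial>lborel)"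
    using assms(2) by (simp only: abs_of_pos add_0)
  then have "ennreal m * (\<integral>\<^sup>+t. ennreal (f (m * t)) \<partial>lborel) < top"
    by (metis ennreal_less_top)
  then have fin: "(\<integral>\<^sup>+t. ennreal (f (m * t)) \<partial>lborel) < top"
    using assms by (auto simp: ennreal_mult_less_top)
  have "(\<integral>\<^sup>+t. ennreal (if 0 < t then t powr a * exp (- m * t) else 0) \<partial>lborel)
      \<le> (\<integral>\<^sup>+t. ennreal (m powr (- a)) * ennreal (f (m * t)) \<partial>lborel)"
  proof (rule nn_integral_mono)
    fix t :: real
    show "ennreal (if 0 < t then t powr a * exp (- m * t) else 0) \<le> ennreal (m powr (- a)) * ennreal (f (m * t))"
    proof (cases "0 < t")
      case True
      have "m powr (- a) * m powr a = 1" using assms by (simp add: powr_minus)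
      then have "m powr (- a) * (m powr a * t powr a) = t powr a" by (metis mult.assoc mult_1)
      then have "t powr a / exp (m * t) = m powr (- a) * ((m * t) powr a / exp (m * t))"
        using assms True by (simp add: powr_mult)
      then have "t powr a * exp (- m * t) = m powr (- a) * f (m * t)"
        using assms True by (simp add: f_def exp_minus divide_inverse)
      then show ?thesis using True by (simp add: ennreal_mult')
    qed simp
  qed
  also have "\<dots> = ennreal (m powr (- a)) * (\<integral>\<^sup>+t. ennreal (f (m * t)) \<partial>lborel)"
    by (rule nn_integral_cmult) measurable
  also have "\<dots> < top" using fin by (simp add: ennreal_mult_less_top)
  finally show ?thesis by simp
qed

text \<open>The contribution of one vertex to the integrand: \<open>l\<close> is its pivot, \<open>q\<close> the squared norm of the rest
  of its row, and \<open>- a\<close> the power of the pivot in the density.\<close>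

definition star_weight :: "real \<Rightarrow> real \<Rightarrow> real \<Rightarrow> real \<Rightarrow> ennreal" where
  "star_weight m a l q = ennreal (if 0 < l then l powr (- a) * exp (- m * (l + q / l)) else 0)"

lemma star_weight_measurable [measurable]:
  "(\<lambda>(l, q). star_weight m a l q) \<in> borel_measurable (borel \<Otimes>\<^sub>M borel)"
  unfolding star_weight_def by measurable

text \<open>For a fixed pivot \<open>l\<close> the other variables carry independent Gaussian densities of variance
  \<open>l / (2 * m)\<close>, whose integrals multiply to a constant times \<open>l powr (card J / 2)\<close>. What remains is
  a Gamma integral with exponent \<open>card J / 2 - a\<close>.\<close>

lemma star_weight_integral_finite:
  fixes J :: "'i set"
  assumes "finite J" and "i \<notin> J" and "0 < m" and a: "a < card J / 2 + 1"
  shows "(\<integral>\<^sup>+x. star_weight m a (x i) (\<Sum>e\<in>J. (x e)\<^sup>2) \<partial>(\<Pi>\<^sub>M e\<in>insert i J. lborel)) < \<infinity>"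
proof -
  interpret product_sigma_finite "\<lambda>e::'i. lborel :: real measure" by standard
  note star_weight_measurable [measurable]
  have split: "star_weight m a l (\<Sum>e\<in>J. (x e)\<^sup>2)
      = ennreal (l powr (- a) * exp (- m * l)) * (\<Prod>e\<in>J. ennreal (exp (- (m / l) * (x e)\<^sup>2)))" if "0 < l" for l x
  proof -
    have "- m * (l + (\<Sum>e\<in>J. (x e)\<^sup>2) / l) = - m * l + (\<Sum>e\<in>J. - (m / l) * (x e)\<^sup>2)"
      by (simp add: algebra_simps sum_divide_distrib sum_distrib_left sum_negf)
    then have "exp (- m * (l + (\<Sum>e\<in>J. (x e)\<^sup>2) / l)) = exp (- m * l) * (\<Prod>e\<in>J. exp (- (m / l) * (x e)\<^sup>2))"
      by (simp only: exp_add exp_sum[OF \<open>finite J\<close>])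
    then show ?thesis
      using that by (simp add: star_weight_def prod_ennreal ennreal_mult' prod_nonneg flip: mult.assoc)
  qed
  have inner: "(\<integral>\<^sup>+x. star_weight m a l (\<Sum>e\<in>J. (x e)\<^sup>2) \<partial>(\<Pi>\<^sub>M e\<in>J. lborel))
      = ennreal ((pi / m) powr (card J / 2)) * ennreal (if 0 < l then l powr (card J / 2 - a) * exp (- m * l) else 0)" for l
  proof (cases "0 < l")
    case True
    have "(\<integral>\<^sup>+x. star_weight m a l (\<Sum>e\<in>J. (x e)\<^sup>2) \<partial>(\<Pi>\<^sub>M e\<in>J. lborel))
        = ennreal (l powr (- a) * exp (- m * l)) *
          (\<integral>\<^sup>+x. (\<Prod>e\<in>J. ennreal (exp (- (m / l) * (x e)\<^sup>2))) \<partial>(\<Pi>\<^sub>M e\<in>J. lborel))"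
      unfolding split[OF True] by (rule nn_integral_cmult) measurable
    also have "(\<integral>\<^sup>+x. (\<Prod>e\<in>J. ennreal (exp (- (m / l) * (x e)\<^sup>2))) \<partial>(\<Pi>\<^sub>M e\<in>J. lborel))
        = (\<Prod>e\<in>J. \<integral>\<^sup>+y. ennreal (exp (- (m / l) * y\<^sup>2)) \<partial>lborel)"
      by (rule product_nn_integral_prod[OF \<open>finite J\<close>]) measurable
    also have "\<dots> = ennreal (sqrt (pi / (m / l))) ^ card J"
      using True assms(3) by (subst nn_integral_gaussian) auto
    also have "\<dots> = ennreal ((pi * l / m) powr (card J / 2))"
      using True assms(3)
      by (simp add: ennreal_power powr_realpow powr_powr flip: powr_half_sqrt powr_realpow)
    finally have "(\<integral>\<^sup>+x. star_weight m a l (\<Sum>e\<in>J. (x e)\<^sup>2) \<partial>(\<Pi>\<^sub>M e\<in>J. lborel))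
        = ennreal (l powr (- a) * exp (- m * l) * (pi * l / m) powr (card J / 2))"
      by (simp add: ennreal_mult')
    also have "l powr (- a) * exp (- m * l) * (pi * l / m) powr (card J / 2)
        = (pi / m) powr (card J / 2) * (l powr (card J / 2 - a) * exp (- m * l))"
    proof -
      have "l powr (card J / 2 - a) = l powr (card J / 2) * l powr (- a)"
        by (simp flip: powr_add)
      moreover have "(pi * l / m) powr (card J / 2) = (pi / m) powr (card J / 2) * l powr (card J / 2)"
        using True assms(3) by (simp flip: powr_mult)
      ultimately show ?thesis by (simp add: mult_ac)
    qed
    finally show ?thesis using True by (simp add: ennreal_mult')
  qed (simp add: star_weight_def)
  have "(\<integral>\<^sup>+x. star_weight m a (x i) (\<Sum>e\<in>J. (x e)\<^sup>2) \<partial>(\<Pi>\<^sub>M e\<in>insert i J. lborel))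
      = (\<integral>\<^sup>+l. \<integral>\<^sup>+x. star_weight m a ((x(i := l)) i) (\<Sum>e\<in>J. ((x(i := l)) e)\<^sup>2) \<partial>(\<Pi>\<^sub>M e\<in>J. lborel) \<partial>lborel)"
    by (rule product_nn_integral_insert_rev[OF assms(1,2)]) measurable
  also have "\<dots> = (\<integral>\<^sup>+l. \<integral>\<^sup>+x. star_weight m a l (\<Sum>e\<in>J. (x e)\<^sup>2) \<partial>(\<Pi>\<^sub>M e\<in>J. lborel) \<partial>lborel)"
  proof -
    have "(\<Sum>e\<in>J. ((x(i := l)) e)\<^sup>2) = (\<Sum>e\<in>J. (x e)\<^sup>2)" for x :: "'i \<Rightarrow> real" and l
      using assms(2) by (intro sum.cong) auto
    then show ?thesis by (simp del: fun_upd_apply) (simp add: fun_upd_same)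
  qed
  also have "\<dots> = ennreal ((pi / m) powr (card J / 2)) *
      (\<integral>\<^sup>+l. ennreal (if 0 < l then l powr (card J / 2 - a) * exp (- m * l) else 0) \<partial>lborel)"
    unfolding inner by (rule nn_integral_cmult) measurable
  also have "\<dots> < \<infinity>"
    using nn_integral_gamma_finite[of "card J / 2 - a" m] assms by (simp add: ennreal_mult_less_top)
  finally show ?thesis .
qed

section \<open>Integration by elimination of vertices\<close>

context perfect_dag begin

text \<open>An elimination order: every vertex comes before its parents, and every suffix of the list is an
  ancestral set.\<close>

primrec reverse_topological :: "'v list \<Rightarrow> bool" where
  "reverse_topological [] \<longleftrightarrow> True"
| "reverse_topological (v # vs) \<longleftrightarrow> v \<notin> set vs \<and> pa v \<subseteq> set vs \<and> reverse_topological vs"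

lemma reverse_topological_closed:
  "reverse_topological vs \<Longrightarrow> w \<in> set vs \<Longrightarrow> pa w \<subseteq> set vs"
  by (induction vs) auto

lemma reverse_topological_exists:
  "ancestral D A \<Longrightarrow> \<exists>vs. reverse_topological vs \<and> set vs = A"
proof (induction "card A" arbitrary: A)
  case 0
  then show ?case by (intro exI[of _ "[]"]) auto
next
  case (Suc n)
  then obtain v0 where "v0 \<in> A" by (metis card.empty equals0I nat.distinct(1))
  then obtain v where v: "v \<in> A" and last: "\<And>y. (y, v) \<in> D\<inverse> \<Longrightarrow> y \<notin> A"
    by (rule wfE_min[OF wf_converse_D]) blast
  have "ancestral D (A - {v})"
    using Suc.prems last by (auto simp: ancestral_def)
  then obtain vs where vs: "reverse_topological vs" "set vs = A - {v}"
  proof -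
    have "n = card (A - {v})"
      using Suc.hyps(2) v by (metis card_Diff_singleton diff_Suc_1)
    then show ?thesis
      using that Suc.hyps(1)[of "A - {v}"] \<open>ancestral D (A - {v})\<close> by blast
  qed
  have "pa v \<subseteq> A - {v}"
    using Suc.prems v not_self_parent[of v] by (auto simp: ancestral_def pa_def)
  then show ?case
    using vs v by (intro exI[of _ "v # vs"]) auto
qed

definition edges_in :: "'v list \<Rightarrow> 'v set set" where
  "edges_in vs = {{i, j} | i j. (i, j) \<in> E \<and> i \<in> set vs \<and> j \<in> set vs}"

definition star :: "'v \<Rightarrow> 'v set set" where
  "star v = (\<lambda>u. {v, u}) ` pa v"

text \<open>One step of Gaussian elimination, in the coordinates indexed by edges. The entry at an edge
  \<open>{i, j}\<close> within the parents of \<open>v\<close> changes by \<open>x {v, i} * x {v, j} / x {v}\<close>. The exponent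
  \<open>2 div card e\<close> makes the product over \<open>e\<close> correct for loops as well, where \<open>i = j\<close> and the single
  factor has to be squared.\<close>

definition schur :: "'v \<Rightarrow> 'v list \<Rightarrow> ('v set \<Rightarrow> real) \<Rightarrow> 'v set \<Rightarrow> real" where
  "schur v vs x = (\<lambda>e\<in>edges_in vs.
     x e - (if e \<subseteq> pa v then (\<Prod>u\<in>e. x {v, u}) ^ (2 div card e) / x {v} else 0))"

text \<open>Every \<open>h v\<close> is evaluated at the pivot and the squared row norm that \<open>v\<close> has at the moment of its
  elimination.\<close>

primrec elimination_weight ::
  "('v \<Rightarrow> real \<Rightarrow> real \<Rightarrow> ennreal) \<Rightarrow> 'v list \<Rightarrow> ('v set \<Rightarrow> real) \<Rightarrow> ennreal" where
  "elimination_weight h [] x = 1"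
| "elimination_weight h (v # vs) x =
     h v (x {v}) (\<Sum>e\<in>star v. (x e)\<^sup>2) * elimination_weight h vs (schur v vs x)"

lemma star_inj: "inj_on (\<lambda>u. {v, u}) A"
  by (auto simp: inj_on_def doubleton_eq_iff)

lemma loop_notin_star: "{v} \<notin> star v"
  using not_self_parent[of v] by (auto simp: star_def)

lemma edges_inI: "(i, j) \<in> E \<Longrightarrow> i \<in> set vs \<Longrightarrow> j \<in> set vs \<Longrightarrow> {i, j} \<in> edges_in vs"
  unfolding edges_in_def by blast

lemma edges_inE:
  assumes "e \<in> edges_in vs"
  obtains i j where "e = {i, j}" "(i, j) \<in> E" "i \<in> set vs" "j \<in> set vs"
  using assms unfolding edges_in_def by blast

lemma last_neighbour_parent:
  assumes "reverse_topological (v # vs)" and "u \<in> set vs" and "(u, v) \<in> E \<or> (v, u) \<in> E"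
  shows "u \<in> pa v"
  using assms reverse_topological_closed[of vs u] adjacent_cases[of u v] adjacent_cases[of v u]
  by auto

text \<open>The children of \<open>v\<close> have been eliminated before it, so \<open>v\<close> is adjacent only to its parents among
  the remaining vertices. Its loop and its star are exactly the edges that disappear with it.\<close>

lemma edges_in_Cons:
  assumes "reverse_topological (v # vs)"
  shows "edges_in (v # vs) = insert {v} (star v) \<union> edges_in vs"
    and "insert {v} (star v) \<inter> edges_in vs = {}"
proof -
  have v: "v \<notin> set vs" "pa v \<subseteq> set vs" using assms by auto
  have nb: "u \<in> pa v" if "u \<in> set vs" "(u, v) \<in> E \<or> (v, u) \<in> E" for u
    using last_neighbour_parent[OF assms] that by blast
  have "(v, v) \<in> E" using refl_E by (simp add: refl_on_def)
  have in_set: "e \<subseteq> set vs" if "e \<in> edges_in vs" for e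
    using that by (rule edges_inE) simp
  have in_star: "v \<in> e" if "e \<in> insert {v} (star v)" for e
    using that by (auto simp: star_def)
  show "insert {v} (star v) \<inter> edges_in vs = {}"
    using in_set in_star v(1) by blast
  show "edges_in (v # vs) = insert {v} (star v) \<union> edges_in vs"
  proof (intro equalityI subsetI)
    fix e assume "e \<in> edges_in (v # vs)"
    then obtain i j where e: "e = {i, j}" and ij: "(i, j) \<in> E" "i \<in> set (v # vs)" "j \<in> set (v # vs)"
      by (rule edges_inE)
    consider "i = v" "j = v" | "i = v" "j \<in> set vs" | "i \<in> set vs" "j = v" | "i \<in> set vs" "j \<in> set vs"
      using ij by auto
    then show "e \<in> insert {v} (star v) \<union> edges_in vs"
    proof cases
      case 1 then show ?thesis by (simp add: e)
    next
      case 2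
      then have "{v, j} \<in> star v" using nb[of j] ij unfolding star_def by blast
      then show ?thesis by (simp add: e 2)
    next
      case 3
      then have "{v, i} \<in> star v" using nb[of i] ij unfolding star_def by blast
      then show ?thesis by (simp add: e 3 insert_commute)
    next
      case 4
      then have "{i, j} \<in> edges_in vs" using ij by (intro edges_inI)
      then show ?thesis by (simp add: e)
    qed
  next
    fix e assume "e \<in> insert {v} (star v) \<union> edges_in vs"
    then consider "e = {v, v}" | u where "u \<in> pa v" "e = {v, u}" | "e \<in> edges_in vs"
      by (auto simp: star_def)
    then show "e \<in> edges_in (v # vs)"
    proof cases
      case 1
      show ?thesis unfolding 1 by (rule edges_inI) (use \<open>(v, v) \<in> E\<close> in simp_all)
    next
      case (2 u)
      show ?thesis unfolding 2(2) by (rule edges_inI) (use 2(1) parent_adjacent v in auto)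
    next
      case 3
      then obtain i j where ij: "e = {i, j}" "(i, j) \<in> E" "i \<in> set vs" "j \<in> set vs"
        by (rule edges_inE)
      show ?thesis unfolding ij(1) by (rule edges_inI) (use ij in simp_all)
    qed
  qed
qed

lemma schur_measurable:
  assumes "reverse_topological (v # vs)"
  shows "schur v vs \<in> (\<Pi>\<^sub>M e\<in>edges_in (v # vs). lborel) \<rightarrow>\<^sub>M (\<Pi>\<^sub>M e\<in>edges_in vs. lborel)"
proof -
  let ?M = "\<Pi>\<^sub>M e\<in>edges_in (v # vs). (lborel :: real measure)"
  have comp: "(\<lambda>x. x e) \<in> borel_measurable ?M" if "e \<in> edges_in (v # vs)" for e
    using measurable_component_singleton[OF that, of "\<lambda>_. lborel :: real measure"] by simp
  show ?thesis
    unfolding schur_def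
  proof (rule measurable_restrict)
    fix e assume "e \<in> edges_in vs"
    then have [measurable]: "(\<lambda>x. x e) \<in> borel_measurable ?M"
      using edges_in_Cons[OF assms] by (intro comp) auto
    have [measurable]: "(\<lambda>x. x {v}) \<in> borel_measurable ?M"
      using edges_in_Cons[OF assms] by (intro comp) auto
    have "(\<lambda>x. \<Prod>u\<in>e. x {v, u}) \<in> borel_measurable ?M" if "e \<subseteq> pa v"
      using edges_in_Cons(1)[OF assms] that by (intro borel_measurable_prod comp) (auto simp: star_def)
    then show "(\<lambda>x. x e - (if e \<subseteq> pa v then (\<Prod>u\<in>e. x {v, u}) ^ (2 div card e) / x {v} else 0)) \<in> ?M \<rightarrow>\<^sub>M lborel"
      by (cases "e \<subseteq> pa v") simp_all
  qed
qed

lemma elimination_weight_measurable: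
  assumes "reverse_topological vs"
    and h: "\<And>v. (\<lambda>(l, q). h v l q) \<in> borel_measurable (borel \<Otimes>\<^sub>M borel)"
  shows "elimination_weight h vs \<in> borel_measurable (\<Pi>\<^sub>M e\<in>edges_in vs. lborel)"
  using assms(1)
proof (induction vs)
  case Nil
  show ?case by simp
next
  case (Cons v vs)
  let ?M = "\<Pi>\<^sub>M e\<in>edges_in (v # vs). (lborel :: real measure)"
  have comp: "(\<lambda>x. x e) \<in> borel_measurable ?M" if "e \<in> edges_in (v # vs)" for e
    using measurable_component_singleton[OF that, of "\<lambda>_. lborel :: real measure"] by simp
  have [measurable]: "(\<lambda>x. x {v}) \<in> borel_measurable ?M"
      "(\<lambda>x. \<Sum>e\<in>star v. (x e)\<^sup>2) \<in> borel_measurable ?M"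
    using edges_in_Cons(1)[OF Cons.prems]
    by (auto intro!: comp borel_measurable_sum borel_measurable_power)
  have [measurable]: "(\<lambda>x. elimination_weight h vs (schur v vs x)) \<in> borel_measurable ?M"
    using Cons by (intro measurable_compose[OF schur_measurable]) auto
  note h[measurable]
  show ?case by simp
qed

text \<open>With the row of \<open>v\<close> fixed, the map \<open>schur\<close> translates the remaining coordinates by a constant, which
  does not change their integral. The factor of \<open>v\<close> therefore splits off by Fubini's theorem.\<close>

lemma elimination_weight_integral:
  assumes "reverse_topological vs"
    and h: "\<And>v. (\<lambda>(l, q). h v l q) \<in> borel_measurable (borel \<Otimes>\<^sub>M borel)"
  shows "(\<integral>\<^sup>+x. elimination_weight h vs x \<partial>(\<Pi>\<^sub>M e\<in>edges_in vs. lborel)) =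
    (\<Prod>v\<in>set vs. \<integral>\<^sup>+x. h v (x {v}) (\<Sum>e\<in>star v. (x e)\<^sup>2) \<partial>(\<Pi>\<^sub>M e\<in>insert {v} (star v). lborel))"
  using assms(1)
proof (induction vs)
  case Nil
  interpret product_sigma_finite "\<lambda>e::'v set. lborel :: real measure" by standard
  show ?case by (simp add: edges_in_def PiM_empty)
next
  case (Cons v vs)
  interpret product_sigma_finite "\<lambda>e::'v set. lborel :: real measure" by standard
  let ?J = "insert {v} (star v)"
  let ?I = "edges_in vs"
  let ?PJ = "\<Pi>\<^sub>M e\<in>?J. (lborel :: real measure)"
  let ?PI = "\<Pi>\<^sub>M e\<in>?I. (lborel :: real measure)"
  note dec = edges_in_Cons[OF Cons.prems]
  have meas: "elimination_weight h vs \<in> borel_measurable ?PI"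
    using Cons.prems by (intro elimination_weight_measurable h) auto
  have "(\<integral>\<^sup>+x. elimination_weight h (v # vs) x \<partial>(\<Pi>\<^sub>M e\<in>edges_in (v # vs). lborel)) =
      (\<integral>\<^sup>+x. \<integral>\<^sup>+y. elimination_weight h (v # vs) (merge ?J ?I (x, y)) \<partial>?PI \<partial>?PJ)"
    unfolding dec(1)
  proof (rule product_nn_integral_fold)
    show "elimination_weight h (v # vs) \<in> borel_measurable (\<Pi>\<^sub>M e\<in>?J \<union> ?I. lborel)"
      using elimination_weight_measurable[OF Cons.prems h] unfolding dec(1) .
  qed (use dec(2) in auto)
  also have "\<dots> = (\<integral>\<^sup>+x. \<integral>\<^sup>+y. h v (x {v}) (\<Sum>e\<in>star v. (x e)\<^sup>2) *
      elimination_weight h vs (\<lambda>e\<in>?I. y e - (if e \<subseteq> pa v then (\<Prod>u\<in>e. x {v, u}) ^ (2 div card e) / x {v} else 0)) \<partial>?PI \<partial>?PJ)"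
  proof (intro nn_integral_cong)
    fix x y :: "'v set \<Rightarrow> real"
    let ?z = "merge ?J ?I (x, y)"
    have J: "?z e = x e" if "e \<in> ?J" for e
      using that by (simp add: merge_def)
    have I: "?z e = y e" if "e \<in> ?I" for e
      using that dec(2) by (auto simp: merge_def)
    have prod: "(\<Prod>u\<in>e. ?z {v, u}) = (\<Prod>u\<in>e. x {v, u})" if "e \<subseteq> pa v" for e
      using that by (intro prod.cong J refl) (auto simp: star_def)
    have "schur v vs ?z = (\<lambda>e\<in>?I. y e - (if e \<subseteq> pa v then (\<Prod>u\<in>e. x {v, u}) ^ (2 div card e) / x {v} else 0))"
      unfolding schur_def by (intro restrict_ext) (simp add: I J prod)
    moreover have "(\<Sum>e\<in>star v. (?z e)\<^sup>2) = (\<Sum>e\<in>star v. (x e)\<^sup>2)"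
      by (intro sum.cong) (auto simp: J)
    ultimately show "elimination_weight h (v # vs) ?z = h v (x {v}) (\<Sum>e\<in>star v. (x e)\<^sup>2) *
      elimination_weight h vs (\<lambda>e\<in>?I. y e - (if e \<subseteq> pa v then (\<Prod>u\<in>e. x {v, u}) ^ (2 div card e) / x {v} else 0))"
      by (simp add: J)
  qed
  also have "\<dots> = (\<integral>\<^sup>+x. h v (x {v}) (\<Sum>e\<in>star v. (x e)\<^sup>2) * (\<integral>\<^sup>+y. elimination_weight h vs y \<partial>?PI) \<partial>?PJ)"
  proof (intro nn_integral_cong)
    fix x :: "'v set \<Rightarrow> real"
    let ?c = "\<lambda>e. if e \<subseteq> pa v then (\<Prod>u\<in>e. x {v, u}) ^ (2 div card e) / x {v} else 0"
    have T: "(\<lambda>y. \<lambda>e\<in>?I. y e - ?c e) \<in> ?PI \<rightarrow>\<^sub>M ?PI" by measurable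
    have "(\<integral>\<^sup>+y. h v (x {v}) (\<Sum>e\<in>star v. (x e)\<^sup>2) * elimination_weight h vs (\<lambda>e\<in>?I. y e - ?c e) \<partial>?PI)
        = h v (x {v}) (\<Sum>e\<in>star v. (x e)\<^sup>2) * (\<integral>\<^sup>+y. elimination_weight h vs (\<lambda>e\<in>?I. y e - ?c e) \<partial>?PI)"
      by (intro nn_integral_cmult measurable_compose[OF T meas])
    also have "(\<integral>\<^sup>+y. elimination_weight h vs (\<lambda>e\<in>?I. y e - ?c e) \<partial>?PI) = (\<integral>\<^sup>+y. elimination_weight h vs y \<partial>?PI)"
      by (intro nn_integral_PiM_lborel_translate meas) simp
    finally show "(\<integral>\<^sup>+y. h v (x {v}) (\<Sum>e\<in>star v. (x e)\<^sup>2) * elimination_weight h vs (\<lambda>e\<in>?I. y e - ?c e) \<partial>?PI)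
        = h v (x {v}) (\<Sum>e\<in>star v. (x e)\<^sup>2) * (\<integral>\<^sup>+y. elimination_weight h vs y \<partial>?PI)" .
  qed
  also have "\<dots> = (\<integral>\<^sup>+x. h v (x {v}) (\<Sum>e\<in>star v. (x e)\<^sup>2) \<partial>?PJ) * (\<integral>\<^sup>+y. elimination_weight h vs y \<partial>?PI)"
  proof (rule nn_integral_multc)
    note h[measurable]
    have comp: "(\<lambda>x. x e) \<in> borel_measurable ?PJ" if "e \<in> ?J" for e
      using measurable_component_singleton[OF that, of "\<lambda>_. lborel :: real measure"] by simp
    have [measurable]: "(\<lambda>x. x {v}) \<in> borel_measurable ?PJ"
        "(\<lambda>x. \<Sum>e\<in>star v. (x e)\<^sup>2) \<in> borel_measurable ?PJ"
      by (auto intro!: comp borel_measurable_sum borel_measurable_power)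
    show "(\<lambda>x. h v (x {v}) (\<Sum>e\<in>star v. (x e)\<^sup>2)) \<in> borel_measurable ?PJ"
      by measurable
  qed
  finally show ?case
    using Cons by simp
qed

end

section \<open>Triangular factorisation by elimination\<close>

context perfect_dag begin

text \<open>Subtracting the pivot times the outer square of the normalised row of \<open>v\<close> clears the row and
  column of \<open>v\<close> and turns the other entries into those of \<open>schur\<close>. New entries arise only between
  parents of \<open>v\<close>, which are adjacent, so the pattern of \<open>E\<close> persists. Positivity is inherited, and
  the outer squares of the successive rows add up to the given matrix.\<close>

lemma elimination:
  assumes "reverse_topological vs"
    and "\<forall>z. (\<exists>i\<in>set vs. z i \<noteq> 0) \<longrightarrow>
      0 < (\<Sum>i\<in>set vs. \<Sum>j\<in>set vs. z i * sym_matrix E x $ i $ j * z j)"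
  shows "\<exists>l L. (\<forall>v\<in>set vs. 0 < l v) \<and>
    (\<forall>v\<in>set vs. L v $ v = 1 \<and> (\<forall>u. u \<noteq> v \<and> u \<notin> pa v \<longrightarrow> L v $ u = 0)) \<and>
    (\<forall>i\<in>set vs. \<forall>j\<in>set vs. sym_matrix E x $ i $ j = (\<Sum>v\<in>set vs. l v * (L v $ i * L v $ j))) \<and>
    elimination_weight h vs x = (\<Prod>v\<in>set vs. h v (l v) (\<Sum>u\<in>pa v. (l v * L v $ u)\<^sup>2))"
  using assms
proof (induction vs arbitrary: x)
  case Nil
  show ?case by simp
next
  case (Cons v vs)
  let ?A = "set vs"
  let ?M = "\<lambda>i j. sym_matrix E x $ i $ j"
  let ?M' = "\<lambda>i j. sym_matrix E (schur v vs x) $ i $ j"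
  have order: "v \<notin> ?A" "pa v \<subseteq> ?A" "reverse_topological vs"
    using Cons.prems(1) by auto
  define d where "d = x {v}"
  define b where "b = (\<lambda>u. if u = v then 1 else if u \<in> pa v then x {v, u} / d else 0)"
  have "(v, v) \<in> E" using refl_E by (simp add: refl_on_def)
  then have M_vv: "?M v v = d" by (simp add: sym_matrix_def d_def)
  have "0 < (\<Sum>i\<in>set (v # vs). \<Sum>j\<in>set (v # vs). (if i = v then 1 else 0) * ?M i j * (if j = v then 1 else 0))"
    by (rule Cons.prems(2)[rule_format]) (auto intro!: bexI[of _ v])
  also have "\<dots> = (\<Sum>i\<in>set (v # vs). if i = v then ?M v v else 0)"
    by (intro sum.cong refl) (auto simp: if_distrib[where f="\<lambda>c. _ * c"] cong: if_cong)
  finally have d: "0 < d" by (simp add: M_vv)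
  have split: "?M i j = d * (b i * b j) + (if i = v \<or> j = v then 0 else ?M' i j)"
    if "i \<in> insert v ?A" "j \<in> insert v ?A" for i j
  proof -
    have border: "?M v w = d * b w \<and> ?M w v = d * b w" if "w \<in> ?A" for w
    proof (cases "w \<in> pa v")
      case True
      then show ?thesis
        using parent_adjacent[OF True] d that order(1)
        by (auto simp: sym_matrix_def b_def insert_commute)
    next
      case False
      then show ?thesis
        using last_neighbour_parent[OF Cons.prems(1) that] that order(1)
        by (auto simp: sym_matrix_def b_def)
    qed
    show ?thesis
    proof (cases "i = v \<or> j = v")
      case True
      then show ?thesis
        using that border[of i] border[of j] M_vv by (auto simp: b_def)
    next
      case False
      then have ij: "i \<in> ?A" "j \<in> ?A" using that by auto
      show ?thesis
      proof (cases "(i, j) \<in> E")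
        case True
        then have "{i, j} \<in> edges_in vs" using ij by (intro edges_inI)
        moreover have "(\<Prod>u\<in>{i, j}. x {v, u}) ^ (2 div card {i, j}) = x {v, i} * x {v, j}"
          by (cases "i = j") (auto simp: power2_eq_square simp flip: numeral_2_eq_2)
        ultimately show ?thesis
          using True False d by (auto simp: sym_matrix_def schur_def b_def simp flip: d_def)
      next
        case nonadj: False
        then have "\<not> (i \<in> pa v \<and> j \<in> pa v)"
          using family_complete[of i v j] by blast
        then show ?thesis
          using nonadj False by (auto simp: sym_matrix_def b_def)
      qed
    qed
  qed
  have "0 < (\<Sum>i\<in>?A. \<Sum>j\<in>?A. z i * ?M' i j * z j)" if nz: "\<exists>i\<in>?A. z i \<noteq> 0" for z
  proof -
    \<comment> \<open>Extend \<open>z\<close> so that it is orthogonal to the column that was split off.\<close>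
    define y where "y = z(v := - (\<Sum>u\<in>?A. b u * z u))"
    have y_A: "y i = z i" if "i \<in> ?A" for i using that order(1) by (auto simp: y_def)
    have "(\<Sum>i\<in>insert v ?A. b i * y i) = y v + (\<Sum>i\<in>?A. b i * z i)"
      using order(1) y_A by (simp add: b_def)
    then have orth: "(\<Sum>i\<in>insert v ?A. b i * y i) = 0" by (simp add: y_def)
    have "0 < (\<Sum>i\<in>insert v ?A. \<Sum>j\<in>insert v ?A. y i * ?M i j * y j)"
      using Cons.prems(2)[rule_format, of y] nz y_A by force
    also have "\<dots> = (\<Sum>i\<in>insert v ?A. \<Sum>j\<in>insert v ?A.
        d * ((b i * y i) * (b j * y j)) + (if i = v \<or> j = v then 0 else y i * ?M' i j * y j))"
      by (intro sum.cong refl) (simp add: split algebra_simps)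
    also have "\<dots> = d * ((\<Sum>i\<in>insert v ?A. b i * y i) * (\<Sum>i\<in>insert v ?A. b i * y i)) +
        (\<Sum>i\<in>insert v ?A. \<Sum>j\<in>insert v ?A. if i = v \<or> j = v then 0 else y i * ?M' i j * y j)"
      unfolding sum_product by (simp only: sum.distrib sum_distrib_left)
    also have "(\<Sum>i\<in>insert v ?A. \<Sum>j\<in>insert v ?A. if i = v \<or> j = v then 0 else y i * ?M' i j * y j)
        = (\<Sum>i\<in>?A. \<Sum>j\<in>insert v ?A. if i = v \<or> j = v then 0 else y i * ?M' i j * y j)"
      using order(1) by (intro sum.mono_neutral_right) auto
    also have "\<dots> = (\<Sum>i\<in>?A. \<Sum>j\<in>?A. if i = v \<or> j = v then 0 else y i * ?M' i j * y j)"
      using order(1) by (intro sum.cong[OF refl] sum.mono_neutral_right) auto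
    also have "\<dots> = (\<Sum>i\<in>?A. \<Sum>j\<in>?A. z i * ?M' i j * z j)"
      using order(1) y_A by (intro sum.cong refl) auto
    finally show ?thesis by (simp add: orth)
  qed
  then have "\<forall>z. (\<exists>i\<in>?A. z i \<noteq> 0) \<longrightarrow> 0 < (\<Sum>i\<in>?A. \<Sum>j\<in>?A. z i * ?M' i j * z j)"
    by blast
  from Cons.IH[OF order(3) this] obtain l L where pos: "\<forall>w\<in>?A. 0 < l w"
    and uni: "\<forall>w\<in>?A. L w $ w = 1 \<and> (\<forall>u. u \<noteq> w \<and> u \<notin> pa w \<longrightarrow> L w $ u = 0)"
    and gram: "\<forall>i\<in>?A. \<forall>j\<in>?A. ?M' i j = (\<Sum>w\<in>?A. l w * (L w $ i * L w $ j))"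
    and weight: "elimination_weight h vs (schur v vs x) = (\<Prod>w\<in>?A. h w (l w) (\<Sum>u\<in>pa w. (l w * L w $ u)\<^sup>2))"
    by (elim exE conjE)
  from uni have diag: "\<And>w. w \<in> ?A \<Longrightarrow> L w $ w = 1"
    and off: "\<And>w u. w \<in> ?A \<Longrightarrow> u \<noteq> w \<Longrightarrow> u \<notin> pa w \<Longrightarrow> L w $ u = 0"
    by simp_all
  define l' where "l' = l(v := d)"
  define L' where "L' = L(v := (\<chi> u. b u))"
  have new: "l' v = d" "\<And>u. L' v $ u = b u" by (simp_all add: l'_def L'_def)
  have old: "l' w = l w" "L' w = L w" if "w \<in> ?A" for w
    using that order(1) by (auto simp: l'_def L'_def)
  have L_v: "L w $ v = 0" if "w \<in> ?A" for w
    using off[OF that, of v] that order reverse_topological_closed[OF order(3) that] by auto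
  show ?case
  proof (intro exI[of _ l'] exI[of _ L'] conjI ballI allI impI)
    fix w assume "w \<in> set (v # vs)"
    then show "0 < l' w" using d pos new old by auto
  next
    fix w assume "w \<in> set (v # vs)"
    then show "L' w $ w = 1" using diag new old by (auto simp: b_def)
  next
    fix w u assume "w \<in> set (v # vs)" "u \<noteq> w \<and> u \<notin> pa w"
    then show "L' w $ u = 0" using off new old by (auto simp: b_def)
  next
    fix i j assume ij: "i \<in> set (v # vs)" "j \<in> set (v # vs)"
    have "(\<Sum>w\<in>set (v # vs). l' w * (L' w $ i * L' w $ j))
        = d * (b i * b j) + (\<Sum>w\<in>?A. l w * (L w $ i * L w $ j))"
      using order(1) by (simp add: new old)
    also have "(\<Sum>w\<in>?A. l w * (L w $ i * L w $ j)) = (if i = v \<or> j = v then 0 else ?M' i j)"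
      using ij gram L_v by (auto intro!: sum.neutral)
    finally show "?M i j = (\<Sum>w\<in>set (v # vs). l' w * (L' w $ i * L' w $ j))"
      using split[of i j] ij by simp
  next
    have "(\<Sum>e\<in>star v. (x e)\<^sup>2) = (\<Sum>u\<in>pa v. (x {v, u})\<^sup>2)"
      by (simp add: star_def sum.reindex[OF star_inj])
    also have "\<dots> = (\<Sum>u\<in>pa v. (d * b u)\<^sup>2)"
      using d not_self_parent[of v] by (intro sum.cong) (auto simp: b_def)
    finally show "elimination_weight h (v # vs) x =
        (\<Prod>w\<in>set (v # vs). h w (l' w) (\<Sum>u\<in>pa w. (l' w * L' w $ u)\<^sup>2))"
      using order(1) by (simp add: new old weight d_def[symmetric])
  qed
qed

lemma cholesky:
  assumes "reverse_topological vs" and "set vs = UNIV" and "sym_matrix E x \<in> P_G E"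
  obtains l L where "unitriangular L" "\<And>v. 0 < l v" "sym_matrix E x = gram l L"
    "elimination_weight h vs x = (\<Prod>v\<in>UNIV. h v (l v) (\<Sum>u\<in>pa v. (l v * L v $ u)\<^sup>2))"
proof -
  have "0 < (\<Sum>i\<in>set vs. \<Sum>j\<in>set vs. z i * sym_matrix E x $ i $ j * z j)"
    if "\<exists>i\<in>set vs. z i \<noteq> 0" for z
  proof -
    define y :: "real^'v" where "y = (\<chi> i. z i)"
    have "y \<noteq> 0" using that by (auto simp: y_def vec_eq_iff)
    then have "0 < y \<bullet> (sym_matrix E x *v y)"
      using assms(3) by (auto simp: P_G_def pos_def_def)
    then show ?thesis
      by (simp add: assms(2) y_def inner_vec_def matrix_vector_mult_def sum_distrib_left mult.assoc)
  qed
  then have "\<forall>z. (\<exists>i\<in>set vs. z i \<noteq> 0) \<longrightarrow>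
      0 < (\<Sum>i\<in>set vs. \<Sum>j\<in>set vs. z i * sym_matrix E x $ i $ j * z j)"
    by blast
  from elimination[where h = h, OF assms(1) this] show ?thesis
    using that unfolding assms(2) by (auto simp: unitriangular_def gram_def vec_eq_iff)
qed

end

section \<open>Measurability of the integrand\<close>

text \<open>Cramer's rule. It exhibits the entries of the inverse as rational functions of those of the
  matrix, which yields measurability.\<close>

lemma matrix_inv_entry:
  fixes A :: "real^'v::finite^'v"
  assumes "pos_def A"
  shows "matrix_inv A $ k $ j = det (\<chi> i l. if l = k then axis j 1 $ i else A $ i $ l) / det A"
proof -
  note inv = pos_def_inverse[OF assms]
  have column: "A *v (matrix_inv A *v axis j 1) = axis j 1"
    by (simp add: matrix_vector_mul_assoc inv)
  have "det (\<chi> i l. if l = k then axis j 1 $ i else A $ i $ l) = (matrix_inv A *v axis j 1) $ k * det A"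
    using cramer_lemma[of k A "matrix_inv A *v axis j 1"] unfolding column .
  moreover have "(matrix_inv A *v axis j 1) $ k = matrix_inv A $ k $ j"
    by (simp add: matrix_vector_mult_def axis_def if_distrib cong: if_cong)
  moreover have "det A \<noteq> 0"
    using inv(3) by (simp add: invertible_det_nz)
  ultimately show ?thesis by simp
qed

lemma borel_measurable_det:
  fixes A :: "'x \<Rightarrow> real^'v::finite^'v"
  assumes [measurable]: "\<And>i j. (\<lambda>x. A x $ i $ j) \<in> borel_measurable M"
  shows "(\<lambda>x. det (A x)) \<in> borel_measurable M"
  unfolding det_def by measurable

lemma borel_measurable_entry [measurable]:
  "(\<lambda>A::real^'v::finite^'v. A $ i $ j) \<in> borel_measurable borel"
  by (intro borel_measurable_continuous_onI continuous_intros)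

text \<open>By \<open>pos_def_coercive\<close>, positive definiteness is a countable union of closed conditions.\<close>

lemma pos_def_alt:
  fixes A :: "real^'v::finite^'v"
  shows "pos_def A \<longleftrightarrow> (\<forall>i j. A $ i $ j = A $ j $ i) \<and>
    (\<exists>n. \<forall>x. inverse (real (Suc n)) * (x \<bullet> x) \<le> x \<bullet> (A *v x))"
proof -
  have tr: "transpose A = A \<longleftrightarrow> (\<forall>i j. A $ i $ j = A $ j $ i)"
    by (auto simp: vec_eq_iff transpose_def)
  have "\<exists>n. \<forall>x. inverse (real (Suc n)) * (x \<bullet> x) \<le> x \<bullet> (A *v x)" if A: "pos_def A"
  proof -
    obtain m where m: "0 < m" "\<And>x. m * (x \<bullet> x) \<le> x \<bullet> (A *v x)"
      using pos_def_coercive[OF A] by blast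
    obtain n where "inverse (real (Suc n)) < m"
      using reals_Archimedean[OF m(1)] by blast
    then have "inverse (real (Suc n)) * (x \<bullet> x) \<le> m * (x \<bullet> x)" for x :: "real^'v"
      by (intro mult_right_mono) auto
    then show ?thesis using m(2) order_trans by blast
  qed
  moreover have "0 < x \<bullet> (A *v x)" if n: "\<forall>x. inverse (real (Suc n)) * (x \<bullet> x) \<le> x \<bullet> (A *v x)" and "x \<noteq> 0" for n x
  proof -
    have "0 < inverse (real (Suc n)) * (x \<bullet> x)" using \<open>x \<noteq> 0\<close> by simp
    also have "\<dots> \<le> x \<bullet> (A *v x)" using n by blast
    finally show ?thesis .
  qed
  ultimately show ?thesis
    unfolding tr[symmetric] unfolding pos_def_def by blast
qed

lemma P_G_measurable: "P_G E \<in> sets borel"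
proof -
  have closed: "closed {A::real^'v^'v. \<forall>x. c * (x \<bullet> x) \<le> x \<bullet> (A *v x)}" for c
    unfolding matrix_vector_mult_def inner_vec_def
    by (intro closed_Collect_all closed_Collect_le continuous_intros)
  have "P_G E = {A. \<forall>i j. A $ i $ j = A $ j $ i} \<inter>
      (\<Union>n. {A. \<forall>x. inverse (real (Suc n)) * (x \<bullet> x) \<le> x \<bullet> (A *v x)}) \<inter>
      {A. \<forall>i j. (i, j) \<notin> E \<longrightarrow> A $ i $ j = 0}"
    unfolding P_G_def pos_def_alt by blast
  also have "\<dots> \<in> sets borel"
    by (intro sets.Int sets.countable_UN image_subsetI borel_closed closed closed_Collect_all
        closed_Collect_imp closed_Collect_eq continuous_intros) auto
  finally show ?thesis .
qed

lemma H_G_inverse_measurable: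
  "(\<lambda>A. H_G r C a b (restrict_matrix E (matrix_inv A))) \<in> borel_measurable (restrict_space borel (P_G E))"
proof -
  let ?R = "restrict_space borel (P_G E)"
  have entry: "(\<lambda>A. A $ i $ j) \<in> borel_measurable ?R" for i j
    by (rule measurable_restrict_space1) measurable
  have "(\<lambda>A. matrix_inv A $ k $ j) \<in> borel_measurable ?R" for k j
  proof -
    have "(\<lambda>A. (\<chi> i l. if l = k then axis j 1 $ i else A $ i $ l) $ i $ l) \<in> borel_measurable ?R" for i l
      by (cases "l = k") (simp_all add: entry)
    then have "(\<lambda>A. det (\<chi> i l. if l = k then axis j 1 $ i else A $ i $ l) / det A) \<in> borel_measurable ?R"
      by (intro borel_measurable_divide borel_measurable_det entry)
    then show ?thesis
      by (rule measurable_cong[THEN iffD1, rotated])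
        (auto simp: space_restrict_space P_G_def matrix_inv_entry)
  qed
  note [measurable] = this
  have [measurable]: "(\<lambda>A. restrict_matrix E (matrix_inv A) p) \<in> borel_measurable ?R" for p
    by (cases p; cases "p \<in> E") (simp_all add: restrict_matrix_def)
  show ?thesis
    unfolding H_G_def det_sub_def by measurable
qed

section \<open>Positivity of principal minors\<close>

text \<open>The segment from the identity to \<open>A\<close> consists of positive definite, hence invertible matrices, so
  the determinant does not change sign on it.\<close>

lemma pos_def_det_pos:
  fixes A :: "real^'v::finite^'v"
  assumes "pos_def A"
  shows "0 < det A"
proof (rule ccontr)
  assume neg: "\<not> 0 < det A"
  define B :: "real \<Rightarrow> real^'v^'v" where
    "B t = (\<chi> i j. (1 - t) * mat 1 $ i $ j + t * A $ i $ j)" for t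
  have B_mult: "B t *v x = (1 - t) *\<^sub>R x + t *\<^sub>R (A *v x)" for t x
  proof -
    have "B t = (1 - t) *\<^sub>R mat 1 + t *\<^sub>R A" by (simp add: B_def vec_eq_iff)
    then show ?thesis
      by (simp add: matrix_vector_mult_add_rdistrib scaleR_matrix_vector_assoc[symmetric])
  qed
  have "continuous_on {0..1} (\<lambda>t. det (B t))"
    unfolding det_def B_def by (simp, intro continuous_intros)
  moreover have "det (B 1) \<le> 0" "0 \<le> det (B 0)"
  proof -
    have "B 1 = A" "B 0 = mat 1" by (simp_all add: B_def vec_eq_iff)
    then show "det (B 1) \<le> 0" "0 \<le> det (B 0)" using neg by simp_all
  qed
  ultimately obtain t where t: "0 \<le> t" "t \<le> 1" "det (B t) = 0"
    using IVT2'[of "\<lambda>t. det (B t)" 1 0 0] by auto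
  then obtain x where x: "x \<noteq> 0" "B t *v x = 0"
    using invertible_det_nz[of "B t"] by (auto simp: invertible_left_inverse matrix_left_invertible_ker)
  have "0 = x \<bullet> (B t *v x)" using x by simp
  also have "\<dots> = (1 - t) * (x \<bullet> x) + t * (x \<bullet> (A *v x))"
    by (simp add: B_mult inner_add_right)
  also have "\<dots> > 0"
  proof (cases "t = 0")
    case True then show ?thesis using x by simp
  next
    case False
    then have "0 < t * (x \<bullet> (A *v x))" using t x assms by (simp add: pos_def_def)
    moreover have "0 \<le> (1 - t) * (x \<bullet> x)" using t by simp
    ultimately show ?thesis by simp
  qed
  finally show False by simp
qed

lemma pos_def_padded:
  fixes A :: "real^'v::finite^'v"
  assumes "pos_def A"
  shows "pos_def (padded A K)"
  unfolding pos_def_def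
proof (intro conjI allI impI)
  have "A $ i $ j = A $ j $ i" for i j
    using assms unfolding pos_def_def by (metis transpose_def vec_lambda_beta)
  then show "transpose (padded A K) = padded A K"
    by (simp add: transpose_def padded_def vec_eq_iff)
  fix x :: "real^'v" assume "x \<noteq> 0"
  define y where "y = (\<chi> i. if i \<in> K then x $ i else 0)"
  define z where "z = x - y"
  have "(padded A K *v x) $ i = (if i \<in> K then (A *v y) $ i else x $ i)" for i
  proof -
    have "(padded A K *v x) $ i = (\<Sum>j\<in>UNIV. if i \<in> K then A $ i $ j * y $ j else if j = i then x $ i else 0)"
      unfolding matrix_vector_mult_def vec_lambda_beta by (intro sum.cong) (auto simp: padded_def y_def)
    then show ?thesis by (simp add: matrix_vector_mult_def)
  qed
  then have "x \<bullet> (padded A K *v x) = (\<Sum>i\<in>UNIV. x $ i * (if i \<in> K then (A *v y) $ i else x $ i))"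
    by (simp add: inner_vec_def)
  also have "\<dots> = (\<Sum>i\<in>UNIV. y $ i * (A *v y) $ i + z $ i * z $ i)"
    by (intro sum.cong) (auto simp: y_def z_def)
  finally have eq: "x \<bullet> (padded A K *v x) = y \<bullet> (A *v y) + z \<bullet> z"
    by (simp add: inner_vec_def sum.distrib)
  show "0 < x \<bullet> (padded A K *v x)"
  proof (cases "y = 0")
    case True
    then show ?thesis using eq \<open>x \<noteq> 0\<close> by (simp add: z_def)
  next
    case False
    then have "0 < y \<bullet> (A *v y)" using assms by (simp add: pos_def_def)
    then show ?thesis unfolding eq by (simp add: add_pos_nonneg)
  qed
qed

section \<open>Perfect orders and induced directed graphs\<close>

locale induced_dag =
  fixes E D :: "'v::finite rel" and r :: nat and C :: "nat \<Rightarrow> 'v set"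
  assumes ugraph: "ugraph E"
    and perfect_order: "perfect_order E r C"
    and dag_version: "dag_version E D"
    and induced: "induced_by r C D"
begin

definition residual :: "nat \<Rightarrow> 'v set" where
  "residual j = C j - history C (j - 1)"

lemma clique: "j \<in> {1..r} \<Longrightarrow> C j \<in> cliques E"
  using perfect_order by (auto simp: perfect_order_def dest: bij_betwE)

lemma clique_complete: "j \<in> {1..r} \<Longrightarrow> complete_in E (C j)"
  using clique by (auto simp: cliques_def)

lemma edge_in_clique:
  assumes "(u, v) \<in> E"
  obtains k where "k \<in> {1..r}" "u \<in> C k" "v \<in> C k"
proof -
  have "complete_in E {u, v}"
    using assms ugraph by (auto simp: complete_in_def ugraph_def refl_on_def sym_def)
  then obtain K where "K \<in> cliques E" "{u, v} \<subseteq> K"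
    by (rule complete_subset_clique)
  moreover have "C ` {1..r} = cliques E"
    using perfect_order by (simp add: perfect_order_def bij_betw_def)
  ultimately show ?thesis using that by (metis image_iff insert_subset)
qed

lemma in_residual:
  obtains j where "j \<in> {1..r}" "v \<in> residual j"
proof -
  have "(v, v) \<in> E" using ugraph by (simp add: ugraph_def refl_on_def)
  then obtain k where k: "k \<in> {1..r} \<and> v \<in> C k" using edge_in_clique by blast
  define j where "j = (LEAST k. k \<in> {1..r} \<and> v \<in> C k)"
  have j: "j \<in> {1..r} \<and> v \<in> C j"
    unfolding j_def by (rule LeastI[of _ k]) (fact k)
  have least: "\<not> (i \<in> {1..r} \<and> v \<in> C i)" if "i < j" for i
    using that unfolding j_def by (rule not_less_Least)
  have "v \<notin> history C (j - 1)"
  proof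
    assume "v \<in> history C (j - 1)"
    then obtain i where "i \<in> {1..j - 1}" "v \<in> C i" by (auto simp: history_def)
    then have "i < j" "i \<in> {1..r}" using j by auto
    then show False using least[of i] \<open>v \<in> C i\<close> by blast
  qed
  then show ?thesis using that j by (auto simp: residual_def)
qed

lemma history_ancestral:
  assumes "j \<le> r"
  shows "ancestral D (history C j)"
proof -
  consider "j = 0" | "j \<in> {1..<r}" | "j = r" using assms by force
  then show ?thesis
  proof cases
    case 3
    have "v \<in> history C r" for v
    proof -
      obtain j where "j \<in> {1..r}" "v \<in> residual j" by (rule in_residual)
      then show ?thesis by (auto simp: residual_def history_def)
    qed
    then show ?thesis by (simp add: 3 ancestral_def)
  qed (use induced in \<open>auto simp: induced_by_def history_def ancestral_def\<close>)
qed

text \<open>If \<open>k > j\<close>, two vertices of the history \<open>H\<^sub>j\<close> that lie in \<open>C\<^sub>k\<close> belong to its separator, and hence to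
  some clique of smaller index. The descent ends at an index at most \<open>j\<close>.\<close>

lemma running_intersection:
  assumes "v \<in> C k" "u \<in> C k" and "k \<in> {1..r}" and "v \<in> history C j" "u \<in> history C j"
  shows "\<exists>i\<in>{1..j}. v \<in> C i \<and> u \<in> C i"
  using assms(1-3)
proof (induction k rule: less_induct)
  case (less k)
  show ?case
  proof (cases "k \<le> j")
    case False
    have "history C j \<subseteq> history C (k - 1)"
      using False by (force simp: history_def)
    moreover have "1 \<le> j" using assms(4) by (auto simp: history_def)
    ultimately have "v \<in> separator C k" "u \<in> separator C k" "k \<in> {2..r}"
      using less.prems assms(4,5) False by (auto simp: separator_def)
    then obtain i where "i \<in> {1..<k}" "v \<in> C i" "u \<in> C i"
      using perfect_order by (fastforce simp: perfect_order_def)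
    then show ?thesis using less.IH[of i] less.prems by auto
  qed (use less.prems in auto)
qed

text \<open>The history \<open>H\<^sub>j\<close> is ancestral, so it contains \<open>u\<close>, and by \<open>running_intersection\<close> the edge \<open>{u, v}\<close>
  lies in a clique \<open>C\<^sub>i\<close> with \<open>i \<le> j\<close>. Since \<open>v\<close> is new in \<open>C\<^sub>j\<close>, this forces \<open>i = j\<close>.\<close>

lemma residual_parents:
  assumes "j \<in> {1..r}" and "v \<in> residual j" and "(u, v) \<in> D"
  shows "u \<in> C j"
proof -
  have v: "v \<in> C j" "v \<notin> history C (j - 1)" using assms(2) by (auto simp: residual_def)
  have hv: "v \<in> history C j" using v(1) assms(1) by (auto simp: history_def)
  then have hu: "u \<in> history C j"
    using history_ancestral[of j] assms(1,3) by (auto simp: ancestral_def)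
  have "(u, v) \<in> E" using assms(3) dag_version by (auto simp: dag_version_def)
  then obtain k where "k \<in> {1..r}" "u \<in> C k" "v \<in> C k" by (rule edge_in_clique)
  then obtain i where i: "i \<in> {1..j}" "v \<in> C i" "u \<in> C i"
    using running_intersection[of v k u j] hv hu by blast
  then have "\<not> i \<in> {1..j - 1}" using v(2) by (auto simp: history_def)
  then have "i = j" using i(1) by auto
  then show ?thesis using i by simp
qed

end

sublocale induced_dag \<subseteq> perfect_dag E D
proof
  show "refl E" using ugraph by (simp add: ugraph_def)
  show "acyclic D" "D \<union> D\<inverse> = E - Id" using dag_version by (auto simp: dag_version_def)
  fix v
  obtain j where j: "j \<in> {1..r}" "v \<in> residual j" by (rule in_residual)
  then show "complete_in E {u. (u, v) \<in> D}"
    using clique_complete[OF j(1)] residual_parents[OF j] by (auto simp: complete_in_def)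
qed

section \<open>Finiteness of the total mass\<close>

lemma ancestral_rtrancl:
  assumes "ancestral D A" and "(v, u) \<in> D\<^sup>*" and "u \<in> A"
  shows "v \<in> A"
  using assms(2,3) by (induction rule: converse_rtrancl_induct) (use assms(1) in \<open>auto simp: ancestral_def\<close>)

context induced_dag begin

text \<open>The power of \<open>1 / l v\<close> in \<open>H_G\<close>. Every clique in which \<open>v\<close> is new contributes \<open>a j\<close>, and every
  ancestral separator that contains \<open>v\<close> contributes \<open>a j - b j\<close>.\<close>

definition exponent :: "(nat \<Rightarrow> real) \<Rightarrow> (nat \<Rightarrow> real) \<Rightarrow> 'v \<Rightarrow> real" where
  "exponent a b v = (\<Sum>j\<in>{1..r}. if v \<in> residual j then a j else 0) +
     (\<Sum>j\<in>{2..r}. if ancestral D (separator C j) \<and> v \<in> separator C j then a j - b j else 0)"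

text \<open>The separator lies in the ancestral set \<open>H\<^sub>j\<^sub>-\<^sub>1\<close>, so no vertex of it descends from a vertex that is
  new in \<open>C\<^sub>j\<close>.\<close>

lemma det_clique_factor:
  assumes "unitriangular L" and "\<And>v. 0 < l v" and "j \<in> {1..r}"
  defines "S \<equiv> matrix_inv (gram l L)"
  shows "det (padded S (C j)) = det (padded S (separator C j)) * (\<Prod>v\<in>residual j. 1 / l v)"
proof -
  have diff: "C j - separator C j = residual j" by (auto simp: residual_def separator_def)
  have "det (padded S (C j)) = det (padded S (separator C j)) * (\<Prod>v\<in>C j - separator C j. 1 / l v)"
    unfolding S_def
  proof (rule det_padded_factor[OF assms(1,2)])
    show "separator C j \<subseteq> C j" by (auto simp: separator_def)
    fix v assume v: "v \<in> C j - separator C j"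
    then show "pa v \<subseteq> C j"
      unfolding diff using residual_parents[OF assms(3)] by (auto simp: pa_def)
    fix u assume "u \<in> separator C j"
    then have "u \<in> history C (j - 1)" by (simp add: separator_def)
    moreover have "v \<notin> history C (j - 1)" using v by (auto simp: separator_def)
    moreover have "ancestral D (history C (j - 1))"
      using assms(3) by (intro history_ancestral) auto
    ultimately show "(v, u) \<notin> D\<^sup>*" by (meson ancestral_rtrancl)
  qed
  then show ?thesis by (simp add: diff)
qed

lemma det_ancestral_factor:
  assumes "unitriangular L" and "\<And>v. 0 < l v" and "ancestral D A"
  shows "det (padded (matrix_inv (gram l L)) A) = (\<Prod>v\<in>A. 1 / l v)"
proof -
  have "pa v \<subseteq> A" if "v \<in> A" for v
    using assms(3) that by (auto simp: ancestral_def pa_def)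
  then have "det (padded (matrix_inv (gram l L)) A) = det (padded (matrix_inv (gram l L)) {}) * (\<Prod>v\<in>A - {}. 1 / l v)"
    by (intro det_padded_factor assms(1,2)) auto
  then show ?thesis by (simp add: det_padded_empty)
qed

text \<open>By \<open>det_clique_factor\<close> the minor on \<open>S\<^sub>j\<close> enters \<open>H_G\<close> with the power \<open>a j - b j\<close>. The power is 0 at
  separators that are not ancestral, and the minors on the ancestral ones are monomials in the
  \<open>l v\<close>.\<close>

lemma H_G_product:
  assumes "unitriangular L" and "\<And>v. 0 < l v"
    and "\<And>j. j \<in> {2..r} \<Longrightarrow> \<not> ancestral D (separator C j) \<Longrightarrow> a j = b j"
  shows "H_G r C a b (restrict_matrix E (matrix_inv (gram l L))) = (\<Prod>v\<in>UNIV. l v powr - exponent a b v)"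
proof -
  define S where "S = matrix_inv (gram l L)"
  define s where "s j = det (padded S (separator C j))" for j
  have "pos_def S" unfolding S_def by (intro pos_def_matrix_inv pos_def_gram assms(1,2))
  then have s_pos: "0 < s j" for j
    unfolding s_def by (intro pos_def_det_pos pos_def_padded)
  have det_C: "det_sub (restrict_matrix E S) (C j) = s j * (\<Prod>v\<in>residual j. 1 / l v)" if "j \<in> {1..r}" for j
    using det_sub_restrict_matrix[OF clique_complete[OF that]] det_clique_factor[OF assms(1,2) that]
    by (simp add: S_def s_def)
  have det_S: "det_sub (restrict_matrix E S) (separator C j) = s j" if "j \<in> {2..r}" for j
  proof -
    have "complete_in E (separator C j)"
      using clique_complete[of j] that by (auto simp: complete_in_def separator_def)
    then show ?thesis by (simp add: det_sub_restrict_matrix s_def)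
  qed
  \<comment> \<open>The first clique is treated like the others, with the empty set as its separator.\<close>
  have s_1: "s j = 1" if "j \<in> {1..r} - {2..r}" for j
  proof -
    have "j = 1" using that by auto
    then show ?thesis by (simp add: s_def separator_def history_def det_padded_empty)
  qed
  have recip: "(1 / l v) powr c = l v powr - c" for v c
    using assms(2)[of v] by (simp add: powr_divide powr_minus_divide)
  have res: "(\<Prod>v\<in>residual j. 1 / l v) powr a j = (\<Prod>v\<in>UNIV. l v powr - (if v \<in> residual j then a j else 0))" for j
  proof -
    have "(\<Prod>v\<in>residual j. 1 / l v) powr a j = (\<Prod>v\<in>residual j. l v powr - a j)"
      by (simp only: prod_powr_distrib recip)
    also have "\<dots> = (\<Prod>v\<in>UNIV. l v powr - (if v \<in> residual j then a j else 0))"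
      by (rule prod.mono_neutral_cong_left) (use assms(2)[THEN less_imp_neq] in auto)
    finally show ?thesis .
  qed
  have sep: "s j powr (a j - b j)
      = (\<Prod>v\<in>UNIV. l v powr - (if ancestral D (separator C j) \<and> v \<in> separator C j then a j - b j else 0))"
    if "j \<in> {2..r}" for j
  proof (cases "ancestral D (separator C j)")
    case True
    have "s j powr (a j - b j) = (\<Prod>v\<in>separator C j. l v powr - (a j - b j))"
      unfolding s_def S_def det_ancestral_factor[OF assms(1,2) True] prod_powr_distrib recip ..
    also have "\<dots> = (\<Prod>v\<in>UNIV. l v powr - (if ancestral D (separator C j) \<and> v \<in> separator C j then a j - b j else 0))"
      by (rule prod.mono_neutral_cong_left) (use assms(2)[THEN less_imp_neq] True in auto)
    finally show ?thesis .
  next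
    case False
    then show ?thesis
      using assms(3)[OF that] s_pos[of j] assms(2)[THEN less_imp_neq] by auto
  qed
  have "H_G r C a b (restrict_matrix E S)
      = (\<Prod>j\<in>{1..r}. s j powr a j * (\<Prod>v\<in>residual j. 1 / l v) powr a j) / (\<Prod>j\<in>{2..r}. s j powr b j)"
    unfolding H_G_def by (intro arg_cong2[where f="(/)"] prod.cong refl) (simp_all add: det_C det_S powr_mult)
  also have "\<dots> = (\<Prod>j\<in>{1..r}. (\<Prod>v\<in>residual j. 1 / l v) powr a j) *
      ((\<Prod>j\<in>{1..r}. s j powr a j) / (\<Prod>j\<in>{2..r}. s j powr b j))"
    by (simp add: prod.distrib)
  also have "(\<Prod>j\<in>{1..r}. s j powr a j) = (\<Prod>j\<in>{2..r}. s j powr a j)"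
    by (rule prod.mono_neutral_right) (auto simp: s_1)
  also have "\<dots> / (\<Prod>j\<in>{2..r}. s j powr b j) = (\<Prod>j\<in>{2..r}. s j powr (a j - b j))"
    by (simp add: prod_dividef powr_diff)
  also have "(\<Prod>j\<in>{1..r}. (\<Prod>v\<in>residual j. 1 / l v) powr a j)
      = (\<Prod>v\<in>UNIV. \<Prod>j\<in>{1..r}. l v powr - (if v \<in> residual j then a j else 0))"
    unfolding res by (rule prod.swap)
  also have "(\<Prod>j\<in>{2..r}. s j powr (a j - b j))
      = (\<Prod>v\<in>UNIV. \<Prod>j\<in>{2..r}. l v powr - (if ancestral D (separator C j) \<and> v \<in> separator C j then a j - b j else 0))"
    by (subst prod.swap) (intro prod.cong refl sep)
  also have "(\<Prod>v\<in>UNIV. \<Prod>j\<in>{1..r}. l v powr - (if v \<in> residual j then a j else 0)) * \<dots>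
      = (\<Prod>v\<in>UNIV. l v powr - exponent a b v)"
    unfolding prod.distrib[symmetric]
  proof (intro prod.cong refl)
    fix v
    have nz: "l v \<noteq> 0" using assms(2)[of v] by simp
    show "(\<Prod>j\<in>{1..r}. l v powr - (if v \<in> residual j then a j else 0)) *
      (\<Prod>j\<in>{2..r}. l v powr - (if ancestral D (separator C j) \<and> v \<in> separator C j then a j - b j else 0))
      = l v powr - exponent a b v"
      unfolding exponent_def minus_add_distrib sum_negf[symmetric] powr_add powr_sum[OF nz] ..
  qed
  finally show ?thesis by (simp add: S_def)
qed

lemma H_G_add:
  "H_G r C a b X * H_G r C a' b' X = H_G r C (\<lambda>j. a j + a' j) (\<lambda>j. b j + b' j) X"
  unfolding H_G_def powr_add prod.distrib times_divide_times_eq ..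

text \<open>Writing \<open>trace (\<Omega> U)\<close> as the sum of the \<open>l v * (L v \<bullet> (U *v L v))\<close> reduces the bound to the single
  vertices, where \<open>l v * (L v \<bullet> L v)\<close> is the pivot plus the squared norm of the rest of the row
  divided by the pivot.\<close>

lemma weight_bound:
  assumes "unitriangular L" and "\<And>v. 0 < l v"
    and "\<And>x. m * (x \<bullet> x) \<le> x \<bullet> (U *v x)"
    and "\<And>j. j \<in> {2..r} \<Longrightarrow> \<not> ancestral D (separator C j) \<Longrightarrow> a j = b j"
  shows "ennreal (exp (- trace (gram l L ** U)) * H_G r C a b (restrict_matrix E (matrix_inv (gram l L))))
    \<le> (\<Prod>v\<in>UNIV. star_weight m (exponent a b v) (l v) (\<Sum>u\<in>pa v. (l v * L v $ u)\<^sup>2))"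
proof -
  have vertex: "m * (l v + (\<Sum>u\<in>pa v. (l v * L v $ u)\<^sup>2) / l v) \<le> l v * (L v \<bullet> (U *v L v))" for v
  proof -
    have "L v \<bullet> L v = (\<Sum>u\<in>insert v (pa v). L v $ u * L v $ u)"
      unfolding inner_vec_def inner_real_def using assms(1)
      by (intro sum.mono_neutral_right) (auto simp: unitriangular_def)
    then have norm: "L v \<bullet> L v = 1 + (\<Sum>u\<in>pa v. (L v $ u)\<^sup>2)"
      using assms(1) not_self_parent[of v] by (simp add: unitriangular_def power2_eq_square)
    have "(\<Sum>u\<in>pa v. (l v * L v $ u)\<^sup>2) = l v * (l v * (\<Sum>u\<in>pa v. (L v $ u)\<^sup>2))"
      by (simp add: power_mult_distrib sum_distrib_left power2_eq_square mult_ac)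
    then have "(\<Sum>u\<in>pa v. (l v * L v $ u)\<^sup>2) / l v = l v * (\<Sum>u\<in>pa v. (L v $ u)\<^sup>2)"
      using assms(2)[of v] by simp
    then have "m * (l v + (\<Sum>u\<in>pa v. (l v * L v $ u)\<^sup>2) / l v) = l v * (m * (L v \<bullet> L v))"
      by (simp add: norm algebra_simps)
    also have "\<dots> \<le> l v * (L v \<bullet> (U *v L v))"
      using assms(2)[of v] assms(3)[of "L v"] by simp
    finally show ?thesis .
  qed
  have "exp (- trace (gram l L ** U)) \<le> exp (\<Sum>v\<in>UNIV. - m * (l v + (\<Sum>u\<in>pa v. (l v * L v $ u)\<^sup>2) / l v))"
    unfolding trace_gram sum_negf[symmetric] using vertex by (intro iffD2[OF exp_le_cancel_iff] sum_mono) simp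
  also have "\<dots> = (\<Prod>v\<in>UNIV. exp (- m * (l v + (\<Sum>u\<in>pa v. (l v * L v $ u)\<^sup>2) / l v)))"
    by (rule exp_sum) simp
  finally have le: "exp (- trace (gram l L ** U)) * (\<Prod>v\<in>UNIV. l v powr - exponent a b v)
      \<le> (\<Prod>v\<in>UNIV. exp (- m * (l v + (\<Sum>u\<in>pa v. (l v * L v $ u)\<^sup>2) / l v))) * (\<Prod>v\<in>UNIV. l v powr - exponent a b v)"
    by (intro mult_right_mono prod_nonneg) auto
  have H: "H_G r C a b (restrict_matrix E (matrix_inv (gram l L))) = (\<Prod>v\<in>UNIV. l v powr - exponent a b v)"
    using assms(1,2,4) by (intro H_G_product)
  show ?thesis
    using le unfolding H star_weight_def
    by (simp add: assms(2) prod_ennreal prod.distrib mult.commute ennreal_leI)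
qed

text \<open>The shifts that define \<open>a\<close> and \<open>b\<close> are the exponents of \<open>nu_G\<close>, so the integrand with respect to
  Lebesgue measure is \<open>exp (- trace (\<Omega> U))\<close> times \<open>H_G\<close> with exponents \<open>a\<close> and \<open>b\<close>. It is
  dominated by an elimination weight whose integral is finite vertex by vertex.\<close>

lemma omega_mass_finite:
  fixes \<alpha> \<beta> :: "nat \<Rightarrow> real"
  defines "a \<equiv> \<lambda>j. \<alpha> j + (real (card (C j)) + 1) / 2"
    and "b \<equiv> \<lambda>j. \<beta> j + (real (card (separator C j)) + 1) / 2"
  assumes "G \<in> Q_G E"
    and cancel: "\<And>j. j \<in> {2..r} \<Longrightarrow> \<not> ancestral D (separator C j) \<Longrightarrow> a j = b j"
    and small: "\<And>v. exponent a b v < card (pa v) / 2 + 1"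
  shows "omega_mass E r C \<alpha> \<beta> G < \<infinity>"
proof -
  define U where "U = completion E G"
  obtain m where m: "0 < m" "\<And>x. m * (x \<bullet> x) \<le> x \<bullet> (U *v x)"
    using pos_def_coercive[OF pos_def_completion[OF assms(3)]] unfolding U_def by blast
  obtain vs where vs: "reverse_topological vs" "set vs = UNIV"
    using reverse_topological_exists[of UNIV] by (auto simp: ancestral_def)
  define h where "h v = star_weight m (exponent a b v)" for v
  have h_meas: "(\<lambda>(l, q). h v l q) \<in> borel_measurable (borel \<Otimes>\<^sub>M borel)" for v
    unfolding h_def by (rule star_weight_measurable)
  define X where "X A = restrict_matrix E (matrix_inv A)" for A :: "real^'v^'v"
  define g where "g = (\<lambda>A. ennreal (H_G r C
    (\<lambda>i. (real (card (C i)) + 1) / 2) (\<lambda>i. (real (card (separator C i)) + 1) / 2) (X A)))"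
  define f where "f = (\<lambda>A. ennreal (exp (- trace (A ** U)) * H_G r C \<alpha> \<beta> (X A)))"
  let ?R = "restrict_space borel (P_G E) :: (real^'v^'v) measure"
  let ?N = "\<Pi>\<^sub>M e\<in>edge_sets E. (lborel :: real measure)"
  have sets: "sets (lebesgue_P_G E) = sets ?R"
    unfolding lebesgue_P_G_def by (intro sets_restrict_space_cong) simp
  have [measurable]: "(\<lambda>A. A $ i $ j) \<in> borel_measurable ?R" for i j
    by (rule measurable_restrict_space1) measurable
  have [measurable]: "(\<lambda>A. H_G r C x y (X A)) \<in> borel_measurable ?R" for x y
    unfolding X_def by (rule H_G_inverse_measurable)
  have [measurable]: "(\<lambda>A. trace (A ** U)) \<in> borel_measurable ?R"
    unfolding trace_def matrix_matrix_mult_def vec_lambda_beta by measurable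
  have g_meas: "g \<in> borel_measurable ?R" unfolding g_def by measurable
  have f_meas: "f \<in> borel_measurable ?R" unfolding f_def by measurable
  have "omega_mass E r C \<alpha> \<beta> G = (\<integral>\<^sup>+A. f A \<partial>density (lebesgue_P_G E) g)"
    by (simp add: omega_mass_def nu_G_def f_def g_def X_def U_def)
  also have "\<dots> = (\<integral>\<^sup>+A. g A * f A \<partial>lebesgue_P_G E)"
    using f_meas g_meas by (intro nn_integral_density) (simp_all add: measurable_cong_sets[OF sets refl])
  also have "\<dots> = (\<integral>\<^sup>+A. g A * f A * indicator (P_G E) A \<partial>distr ?N borel (sym_matrix E))"
    unfolding lebesgue_P_G_def by (rule nn_integral_restrict_space) (simp add: P_G_measurable)
  also have "\<dots> = (\<integral>\<^sup>+x. g (sym_matrix E x) * f (sym_matrix E x) * indicator (P_G E) (sym_matrix E x) \<partial>?N)"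
  proof (rule nn_integral_distr[OF measurable_sym_matrix])
    have "(\<lambda>A. g A * f A) \<in> borel_measurable ?R"
      using f_meas g_meas by measurable
    then show "(\<lambda>A. g A * f A * indicator (P_G E) A) \<in> borel_measurable (distr ?N borel (sym_matrix E))"
      by (subst (asm) borel_measurable_restrict_space_iff_ennreal) (simp_all add: P_G_measurable)
  qed
  also have "\<dots> \<le> (\<integral>\<^sup>+x. elimination_weight h vs x \<partial>?N)"
  proof (rule nn_integral_mono)
    fix x
    show "g (sym_matrix E x) * f (sym_matrix E x) * indicator (P_G E) (sym_matrix E x) \<le> elimination_weight h vs x"
    proof (cases "sym_matrix E x \<in> P_G E")
      case True
      obtain l L where lL: "unitriangular L" "\<And>v. 0 < l v" "sym_matrix E x = gram l L"
        "elimination_weight h vs x = (\<Prod>v\<in>UNIV. h v (l v) (\<Sum>u\<in>pa v. (l v * L v $ u)\<^sup>2))"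
        using cholesky[where h = h, OF vs True] by blast
      define A where "A = gram l L"
      have nonneg: "0 \<le> H_G r C y z (X A)" for y z
        by (simp add: H_G_def prod_nonneg)
      have "g A * f A = ennreal (exp (- trace (A ** U)) * (H_G r C \<alpha> \<beta> (X A) * H_G r C
          (\<lambda>i. (real (card (C i)) + 1) / 2) (\<lambda>i. (real (card (separator C i)) + 1) / 2) (X A)))"
        unfolding f_def g_def using nonneg by (simp add: ennreal_mult'[symmetric] mult_ac)
      also have "\<dots> = ennreal (exp (- trace (A ** U)) * H_G r C a b (X A))"
        unfolding H_G_add a_def b_def ..
      also have "\<dots> \<le> elimination_weight h vs x"
        using weight_bound[OF lL(1,2) m(2) cancel] unfolding lL(4) h_def A_def X_def by simp
      finally show ?thesis using True by (simp add: lL(3) A_def)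
    qed simp
  qed
  also have "\<dots> = (\<Prod>v\<in>UNIV. \<integral>\<^sup>+x. h v (x {v}) (\<Sum>e\<in>star v. (x e)\<^sup>2) \<partial>(\<Pi>\<^sub>M e\<in>insert {v} (star v). lborel))"
  proof -
    have "edge_sets E = edges_in vs" by (simp add: edge_sets_def edges_in_def vs(2))
    then show ?thesis using elimination_weight_integral[OF vs(1) h_meas] by (simp add: vs(2))
  qed
  also have "\<dots> < \<infinity>"
  proof -
    have fin: "(\<integral>\<^sup>+x. h v (x {v}) (\<Sum>e\<in>star v. (x e)\<^sup>2) \<partial>(\<Pi>\<^sub>M e\<in>insert {v} (star v). lborel)) < \<infinity>" for v
    proof -
      have "card (star v) = card (pa v)" by (simp add: star_def card_image[OF star_inj])
      then show ?thesis
        unfolding h_def using small[of v] m(1)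
        by (intro star_weight_integral_finite loop_notin_star) simp_all
    qed
    have "(\<Prod>v\<in>A. \<integral>\<^sup>+x. h v (x {v}) (\<Sum>e\<in>star v. (x e)\<^sup>2) \<partial>(\<Pi>\<^sub>M e\<in>insert {v} (star v). lborel)) < \<infinity>"
      if "finite A" for A
      using that by (induction A rule: finite_induct) (use fin in \<open>simp_all add: ennreal_mult_less_top\<close>)
    then show ?thesis by simp
  qed
  finally show ?thesis .
qed

end

section \<open>Open pieces of affine subspaces as submanifolds\<close>

text \<open>Derivatives on an open set depend only on the values there; \<open>f\<close> is arbitrary elsewhere.\<close>

lemma times_differentiable_on_const:
  fixes f :: "'a::euclidean_space \<Rightarrow> 'b::euclidean_space"
  assumes "open U"
  shows "(\<And>x. x \<in> U \<Longrightarrow> f x = k) \<Longrightarrow> times_differentiable_on n U f"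
proof (induction n arbitrary: f k)
  case 0
  then show ?case by (simp add: continuous_on_cong[of U U f "\<lambda>_. k"])
next
  case (Suc n)
  have deriv: "(f has_derivative (\<lambda>_. 0)) (at x)" if "x \<in> U" for x
    by (rule has_derivative_transform_within_open[OF has_derivative_const[of k] assms that])
      (simp add: Suc.prems)
  have "times_differentiable_on n U (\<lambda>x. frechet_derivative f (at x) v)" for v
    by (rule Suc.IH[of _ 0]) (simp add: frechet_derivative_at[OF deriv, symmetric])
  then show ?case using deriv by (auto simp: differentiable_def)
qed

text \<open>Agreement with a translation is required on \<open>U\<close> only, so as to cover the map \<open>the_inv_into\<close>, which
  is unspecified outside the image.\<close>

lemma smooth_on_translation:
  fixes f :: "'a::euclidean_space \<Rightarrow> 'a"
  assumes "open U" and f: "\<And>x. x \<in> U \<Longrightarrow> f x = x + c"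
  shows "smooth_on U f"
  unfolding smooth_on_def
proof
  fix n
  show "times_differentiable_on n U f"
  proof (cases n)
    case 0
    then show ?thesis
      using f by (simp add: continuous_on_cong[of U U f "\<lambda>x. x + c"] continuous_intros)
  next
    case (Suc n)
    have deriv: "(f has_derivative (\<lambda>v. v)) (at x)" if "x \<in> U" for x
    proof (rule has_derivative_transform_within_open[OF _ assms(1) that])
      show "((\<lambda>x. x + c) has_derivative (\<lambda>v. v)) (at x)"
        by (auto intro!: derivative_eq_intros)
    qed (simp add: f)
    have "times_differentiable_on n U (\<lambda>x. frechet_derivative f (at x) v)" for v
      by (rule times_differentiable_on_const[OF assms(1), of _ v])
        (simp add: frechet_derivative_at[OF deriv, symmetric])
    then show ?thesis using deriv by (auto simp: Suc differentiable_def)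
  qed
qed

lemma diffeo_translation:
  fixes U :: "'a::euclidean_space set"
  assumes "open U"
  shows "diffeo U ((\<lambda>x. x + c) ` U) (\<lambda>x. x + c)"
proof -
  have inj: "inj_on (\<lambda>x. x + c) U" by (simp add: inj_on_def)
  have op: "open ((\<lambda>x. x + c) ` U)"
    using open_translation[OF assms, of c] by (simp add: add.commute)
  have inv: "the_inv_into U (\<lambda>x. x + c) y = y + - c" if "y \<in> (\<lambda>x. x + c) ` U" for y
    using that the_inv_into_f_f[OF inj] by auto
  show ?thesis
    unfolding diffeo_def
    using assms op inj smooth_on_translation[OF assms, of "\<lambda>x. x + c" c]
      smooth_on_translation[OF op inv] by (auto simp: bij_betw_def)
qed

text \<open>The translation by \<open>- q\<close> is a chart at \<open>q\<close>: it preserves \<open>X\<close> because \<open>q \<in> X\<close>, and it carries the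
  affine subspace through \<open>q\<close> to its direction space \<open>W\<close>.\<close>

lemma submanifold_of_relatively_open:
  fixes X W U :: "'a::euclidean_space set"
  assumes "subspace X" and "subspace W" and "W \<subseteq> X" and "open U"
    and M: "M = U \<inter> (\<lambda>w. w + p) ` W" and "p \<in> X" and "M \<noteq> {}"
  shows "submanifold_of X (dim W) M"
  unfolding submanifold_of_def
proof (intro conjI ballI)
  show "M \<subseteq> X"
    using assms(1,3,6) by (auto simp: M intro: subspace_add)
  fix q assume q: "q \<in> M"
  then have q': "q \<in> U" "q - p \<in> W" "q \<in> X"
    using \<open>M \<subseteq> X\<close> by (auto simp: M)
  let ?\<phi> = "\<lambda>x. x + - q"
  have "?\<phi> ` (U \<inter> X) = ?\<phi> ` U \<inter> X"
  proof -
    have "x + - q \<in> X \<longleftrightarrow> x \<in> X" for x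
      using subspace_add[OF assms(1), of "x + - q" q] subspace_diff[OF assms(1), of x q] q'(3) by auto
    then show ?thesis by auto
  qed
  moreover have "?\<phi> ` (U \<inter> M) = ?\<phi> ` U \<inter> W"
  proof -
    have "x \<in> (\<lambda>w. w + p) ` W \<longleftrightarrow> x + - q \<in> W" for x
    proof -
      have "x \<in> (\<lambda>w. w + p) ` W \<longleftrightarrow> x - p \<in> W"
        by (auto simp: image_iff intro: bexI[of _ "x - p"])
      also have "\<dots> \<longleftrightarrow> x + - q \<in> W"
        using subspace_add[OF assms(2), of "x + - q" "q - p"] subspace_diff[OF assms(2), of "x - p" "q - p"] q'(2)
        by auto
      finally show ?thesis .
    qed
    then show ?thesis by (auto simp: M)
  qed
  ultimately show "\<exists>U V \<phi> W'. q \<in> U \<and> diffeo U V \<phi> \<and> \<phi> ` (U \<inter> X) = V \<inter> X \<and>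
        subspace W' \<and> W' \<subseteq> X \<and> dim W' = dim W \<and> \<phi> ` (U \<inter> M) = V \<inter> W'"
    using diffeo_translation[OF assms(4), of "- q"] q'(1) assms(2,3) by blast
qed (fact assms(7))

lemma subspace_param_space: "subspace (param_space r C)"
  by (auto simp: subspace_def param_space_def zero_prod_def)

section \<open>The family of finite parameters\<close>

context induced_dag begin

definition nonancestral :: "'v set set" where
  "nonancestral = C ` {j \<in> {2..r}. \<not> ancestral D (separator C j)}"

text \<open>The equations \<open>a\<^sub>j = b\<^sub>j\<close> at separators that are not ancestral differ from \<open>\<alpha>\<^sub>j = \<beta>\<^sub>j\<close> by constants, so
  this is the direction space of their solution set.\<close>

definition directions :: "((real^('v set)) \<times> (real^('v set))) set" where
  "directions = {(\<alpha>, \<beta>) \<in> param_space r C. \<forall>K\<in>nonancestral. \<alpha> $ K = \<beta> $ K}"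

lemma subspace_directions: "subspace directions"
  unfolding directions_def param_space_def
  by (auto simp: subspace_def zero_prod_def)

lemma C_inj: "inj_on C {1..r}"
  using perfect_order by (auto simp: perfect_order_def bij_betw_def)

text \<open>All \<open>\<alpha>\<^sub>j\<close>, and the \<open>\<beta>\<^sub>j\<close> with ancestral separator, can be chosen freely; the remaining \<open>\<beta>\<^sub>j\<close> are then
  equal to \<open>\<alpha>\<^sub>j\<close>. Several indices may share a separator, so there are at least as many free \<open>\<beta>\<^sub>j\<close>
  as ancestral separators.\<close>

lemma dim_directions: "r + num_ancestral_separators r C D \<le> dim directions"
proof -
  let ?J = "{j \<in> {2..r}. ancestral D (separator C j)}"
  define S :: "((real^('v set)) \<times> (real^('v set))) set" where
    "S = (\<lambda>K. (axis K 1, 0)) ` C ` {1..r} \<union> (\<lambda>K. (0, axis K 1)) ` C ` ?J"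
  \<comment> \<open>A shear that copies \<open>\<alpha>\<^sub>j\<close> to \<open>\<beta>\<^sub>j\<close> where the two have to agree.\<close>
  define F :: "(real^('v set)) \<times> (real^('v set)) \<Rightarrow> (real^('v set)) \<times> (real^('v set))" where
    "F = (\<lambda>(\<alpha>, \<beta>). (\<alpha>, \<beta> + (\<chi> K. if K \<in> nonancestral then \<alpha> $ K else 0)))"
  have "S \<subseteq> Basis"
    by (auto simp: S_def Basis_prod_def Basis_vec_def)
  then have indep: "independent S" by (rule independent_mono[OF independent_Basis])
  have inj_axis: "inj_on (\<lambda>K::'v set. (axis K 1 :: real^('v set), 0 :: real^('v set))) A"
      "inj_on (\<lambda>K::'v set. (0 :: real^('v set), axis K 1 :: real^('v set))) A" for A
    by (auto simp: inj_on_def axis_eq_axis)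
  have "card S = card (C ` {1..r}) + card (C ` ?J)"
    unfolding S_def by (subst card_Un_disjoint) (auto simp: card_image inj_axis axis_eq_0_iff)
  also have "\<dots> = r + card ?J"
  proof -
    have "inj_on C ?J" by (rule inj_on_subset[OF C_inj]) auto
    then show ?thesis using C_inj by (simp add: card_image)
  qed
  finally have card_S: "card S = r + card ?J" .
  have "linear F"
    unfolding F_def by (rule linearI) (auto simp: vec_eq_iff algebra_simps)
  moreover have "inj F"
    unfolding F_def by (auto intro!: injI)
  ultimately have "dim (F ` S) = dim S"
    by (intro dim_image_eq) (auto intro: inj_on_subset)
  moreover have "F ` S \<subseteq> directions"
  proof -
    have non: "nonancestral \<subseteq> C ` {2..r}" "C ` {2..r} \<subseteq> C ` {1..r}"
      by (auto simp: nonancestral_def)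
    have disj: "C j \<notin> nonancestral" if "j \<in> ?J" for j
    proof
      assume "C j \<in> nonancestral"
      then obtain k where k: "k \<in> {2..r}" "\<not> ancestral D (separator C k)" "C j = C k"
        by (auto simp: nonancestral_def)
      then have "j = k" using that inj_onD[OF C_inj k(3)] by auto
      then show False using k that by simp
    qed
    have 1: "F (axis K 1, 0) \<in> directions" if "K \<in> C ` {1..r}" for K
      using that non by (auto simp: F_def directions_def param_space_def axis_def)
    have 2: "F (0, axis (C j) 1) \<in> directions" if "j \<in> ?J" for j
      using that disj[OF that] by (auto simp: F_def directions_def param_space_def axis_def)
    show ?thesis unfolding S_def using 1 2 by auto
  qed
  ultimately have "dim S \<le> dim directions"
    by (metis dim_subset)
  then have "r + card ?J \<le> dim directions"
    using indep by (simp add: dim_eq_card_independent card_S)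
  moreover have "{S \<in> separator C ` {2..r}. ancestral D S} = separator C ` ?J" by auto
  then have "num_ancestral_separators r C D \<le> card ?J"
    unfolding num_ancestral_separators_def by (simp add: card_image_le)
  ultimately show ?thesis by linarith
qed

definition clique_shift :: "(real^('v set)) \<Rightarrow> nat \<Rightarrow> real" where
  "clique_shift \<alpha> j = \<alpha> $ C j + (real (card (C j)) + 1) / 2"

definition separator_shift :: "(real^('v set)) \<Rightarrow> nat \<Rightarrow> real" where
  "separator_shift \<beta> j = \<beta> $ C j + (real (card (separator C j)) + 1) / 2"

definition integrable_exponents :: "((real^('v set)) \<times> (real^('v set))) set" where
  "integrable_exponents = {(\<alpha>, \<beta>). \<forall>v.
     exponent (clique_shift \<alpha>) (separator_shift \<beta>) v < card (pa v) / 2 + 1}"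

lemma open_integrable_exponents: "open integrable_exponents"
proof -
  have "integrable_exponents = (\<Inter>v. {p. exponent (clique_shift (fst p)) (separator_shift (snd p)) v < card (pa v) / 2 + 1})"
    by (auto simp: integrable_exponents_def)
  also have "open \<dots>"
  proof (intro open_INT ballI open_Collect_less continuous_intros)
    fix v
    have *: "continuous_on UNIV (\<lambda>p::(real^('v set)) \<times> (real^('v set)). if P then f p else 0)"
      if "continuous_on UNIV f" for P and f :: "_ \<Rightarrow> real"
      using that by (cases P) simp_all
    show "continuous_on UNIV (\<lambda>p. exponent (clique_shift (fst p)) (separator_shift (snd p)) v)"
      unfolding exponent_def clique_shift_def separator_shift_def
      by (intro continuous_intros *)
  qed simp_all
  finally show ?thesis .
qed

text \<open>At this parameter all shifted exponents vanish, and the measure is \<open>exp (- trace (\<Omega> U))\<close> times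
  Lebesgue measure. The index \<open>j\<close> of a coordinate \<open>K = C j\<close> is recovered by inverting \<open>C\<close>.\<close>

definition base_point :: "(real^('v set)) \<times> (real^('v set))" where
  "base_point =
    ((\<chi> K. if K \<in> C ` {1..r} then - ((real (card K) + 1) / 2) else 0),
     (\<chi> K. if K \<in> C ` {2..r} then - ((real (card (separator C (the_inv_into {1..r} C K))) + 1) / 2) else 0))"

lemma base_point_shift:
  "j \<in> {1..r} \<Longrightarrow> clique_shift (fst base_point) j = 0"
  "j \<in> {2..r} \<Longrightarrow> separator_shift (snd base_point) j = 0"
  using the_inv_into_f_f[OF C_inj, of j]
  by (auto simp: clique_shift_def separator_shift_def base_point_def field_simps)

lemma base_point_in_param_space: "base_point \<in> param_space r C"
  by (auto simp: base_point_def param_space_def)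

lemma base_point_integrable: "base_point \<in> integrable_exponents"
proof -
  have "exponent (clique_shift (fst base_point)) (separator_shift (snd base_point)) v = 0" for v
    unfolding exponent_def
    by (intro add_0_left[of 0, THEN [2] trans] arg_cong2[where f="(+)"] sum.neutral) (auto simp: base_point_shift)
  then show ?thesis
    by (simp add: integrable_exponents_def split_beta add_nonneg_pos)
qed

lemma finite_params_submanifold:
  defines "M \<equiv> integrable_exponents \<inter> (\<lambda>w. w + base_point) ` directions"
  shows "submanifold_of (param_space r C) (dim directions) M" and "M \<subseteq> finite_params E r C"
proof -
  have "base_point \<in> M"
    unfolding M_def using base_point_integrable subspace_0[OF subspace_directions]
    by (auto intro: image_eqI[of _ _ 0])
  moreover have "directions \<subseteq> param_space r C"
    by (auto simp: directions_def)
  ultimately show "submanifold_of (param_space r C) (dim directions) M"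
    unfolding M_def
    by (intro submanifold_of_relatively_open[OF subspace_param_space subspace_directions _
          open_integrable_exponents refl base_point_in_param_space]) auto
  show "M \<subseteq> finite_params E r C"
  proof
    fix q assume "q \<in> M"
    then obtain w where w: "w \<in> directions" "q = w + base_point" and q: "q \<in> integrable_exponents"
      by (auto simp: M_def)
    obtain \<alpha> \<beta> where q_eq: "q = (\<alpha>, \<beta>)" by force
    have "w \<in> param_space r C" using w(1) by (auto simp: directions_def)
    then have "q \<in> param_space r C"
      unfolding w(2) by (intro subspace_add subspace_param_space base_point_in_param_space)
    moreover have "omega_mass E r C (\<lambda>i. \<alpha> $ C i) (\<lambda>i. \<beta> $ C i) G < \<infinity>" if "G \<in> Q_G E" for G
    proof (rule omega_mass_finite[OF that])
      fix j assume j: "j \<in> {2..r}" "\<not> ancestral D (separator C j)"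
      then have "C j \<in> nonancestral" by (auto simp: nonancestral_def)
      then have "fst w $ C j = snd w $ C j" using w(1) by (auto simp: directions_def)
      moreover have "\<alpha> = fst w + fst base_point" "\<beta> = snd w + snd base_point"
        using w(2) q_eq by (simp_all add: prod_eq_iff)
      ultimately show "\<alpha> $ C j + (real (card (C j)) + 1) / 2 = \<beta> $ C j + (real (card (separator C j)) + 1) / 2"
        using base_point_shift[of j] j by (simp add: clique_shift_def separator_shift_def)
    next
      fix v
      show "exponent (\<lambda>j. \<alpha> $ C j + (real (card (C j)) + 1) / 2)
          (\<lambda>j. \<beta> $ C j + (real (card (separator C j)) + 1) / 2) v < real (card (pa v)) / 2 + 1"
        using q unfolding q_eq integrable_exponents_def
        by (simp add: clique_shift_def[abs_def] separator_shift_def[abs_def])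
    qed
    ultimately show "q \<in> finite_params E r C"
      by (simp add: finite_params_def q_eq)
  qed
qed

end

theorem proposition5p1:
  fixes E D :: "'v::finite rel" and r :: nat and C :: "nat \<Rightarrow> 'v set"
  assumes "ugraph E"
    and "decomposable E"
    and "perfect_order E r C"
    and "dag_version E D"
    and "induced_by r C D"
  shows "\<exists>d M. d \<ge> r + num_ancestral_separators r C D \<and>
           submanifold_of (param_space r C) d M \<and> M \<subseteq> finite_params E r C"
proof -
  interpret induced_dag E D r C
    using assms by unfold_locales
  show ?thesis
    using dim_directions finite_params_submanifold by blast
qed

end
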